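(* The Davey--Stewartson flow preserves isothermic surfaces in $4$-space, in the following sense. Let $M=T^2$ be a torus with a fixed complex structure, $z$ a holomorphic coordinate on its universal cover as in the context, and let $f(t):M\to S^4$ be a smooth family of conformal immersions with normal variation $\sigma=\mathrm{Re}\,J\kappa$ and with $\int_M b=0$. If at some time $t$ the surface $f(t)$ is isothermic with $\kappa=\bar\kappa$ in the coordinate $z$, then at that time $b=0$, $$D_t\kappa=J\big(D_zD_z\kappa+\tfrac c2\kappa\big)\qquad\text{and}\qquad \mathrm{Im}\,(D_t\kappa)=0,$$ i.e. the reality condition $\kappa=\bar\kappa$ is preserved by the flow.
   Context: Let $\mathbb R^{5,1}$ carry the Lorentzian form $\langle v,v\rangle=-v_0^2+\sum_{k=1}^{5}v_k^2$ (extended complex bilinearly), with forward light cone $\mathcal L_+$; identify $S^4$ with the projectivized light cone via $x\leftrightarrow[1:x]$. On the torus $M=T^2$ fix a nowhere vanishing holomorphic vector field $X$ and let $z$ be the holomorphic coordinate on the universal cover for which $\frac{\partial}{\partial z}$ is the $(1,0)$-part of $X$; $\partial_z,\partial_{\bar z}$ and $|dz|^2$ are globally defined on $M$, and integrals over $M$ are with respect to the area measure of $|dz|^2$. For a conformal immersion $f:M\to S^4$ there is a unique normalized lift $\psi:M\to\mathcal L_+$ such that $\psi(p)$ spans the null line $f(p)$ and $|d\psi|^2=|dz|^2$. Let $V=\mathrm{span}\{\psi,d\psi,\psi_{z\bar z}\}$, a rank $4$ subbundle of $M\times\mathbb R^{5,1}$ of signature $(3,1)$. The bundle $V^\perp$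 is an oriented rank $2$ Euclidean bundle; it carries the connection $D$ obtained by projecting the derivative to $V^\perp$ (for families, $D_t$ is the projection of $\partial_t$ to $V(t)^\perp$) and the $D$-parallel orthogonal complex structure $J$ given by $90$-degree rotation, extended complex linearly to $V^\perp\otimes\mathbb C$. The equation $\psi_{zz}+\frac c2\psi=\kappa$ defines the Schwarzian derivative $c$ (a complex valued function) and the Hopf differential $\kappa\in\Gamma(V^\perp\otimes\mathbb C)$. The surface is isothermic (in the coordinate $z$) if $\kappa=\bar\kappa$. For a smooth family $f(t)$ of conformal immersions with normalized lifts $\psi(t)$ one has $$\psi_t=a\psi+b\psi_z+\bar b\psi_{\bar z}+\sigma$$ with $a$ real valued, $b$ complex valued and $\sigma\in\Gamma(V^\perp)$, the normal variation; conformality is equivalent to $\partial_z(\bar b)=2\langle\sigma,\kappa\rangle$ and $a=-\mathrm{Re}\,b_z$. The Davey--Stewartson flow is the one with $\sigma=\mathrm{Re}\,J\kappa=\frac12(J\kappa+J\bar\kappa)$ and $\int_M b=0$. *)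

theory Defs
  imports "HOL-Analysis.Analysis"
begin

section \<open>Smooth maps\<close>

text \<open>
  \<open>k\<close>-fold continuous differentiability and smoothness of a map on an open subset \<open>S\<close> of a
  finite-dimensional space, by iterated directional derivatives.
\<close>

primrec Ck_on :: "nat \<Rightarrow> 'a::euclidean_space set \<Rightarrow> ('a \<Rightarrow> 'b::real_normed_vector) \<Rightarrow> bool" where
  "Ck_on 0 S g \<longleftrightarrow> continuous_on S g"
| "Ck_on (Suc k) S g \<longleftrightarrow>
     (\<forall>x\<in>S. g differentiable (at x)) \<and> (\<forall>v. Ck_on k S (\<lambda>x. frechet_derivative g (at x) v))"

definition smooth_on :: "'a::euclidean_space set \<Rightarrow> ('a \<Rightarrow> 'b::real_normed_vector) \<Rightarrow> bool" where
  "smooth_on S g \<longleftrightarrow> (\<forall>k. Ck_on k S g)"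


section \<open>Lorentzian space and its complexification\<close>

text \<open>
  The index \<open>None\<close> is the time coordinate \<open>v\<^sub>0\<close>; the indices \<open>Some k\<close> are the five space
  coordinates.
\<close>

type_synonym lvec = "real ^ (5 option)"
type_synonym lvecC = "complex ^ (5 option)"

definition lorentz :: "lvec \<Rightarrow> lvec \<Rightarrow> real" where
  "lorentz v w = - (v $ None * w $ None) + (\<Sum>k\<in>UNIV. v $ Some k * w $ Some k)"

definition forward_cone :: "lvec set" where
  "forward_cone = {v. lorentz v v = 0 \<and> v $ None > 0}"

text \<open>The representative \<open>(1, x)\<close> of the null line \<open>[1 : x]\<close>.\<close>

definition null_rep :: "real ^ 5 \<Rightarrow> lvec" where
  "null_rep x = (\<chi> i. case i of None \<Rightarrow> 1 | Some k \<Rightarrow> x $ k)"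

definition cvec :: "lvec \<Rightarrow> lvecC" where
  "cvec v = (\<chi> i. complex_of_real (v $ i))"

definition Rev :: "lvecC \<Rightarrow> lvec" where
  "Rev w = (\<chi> i. Re (w $ i))"

definition Imv :: "lvecC \<Rightarrow> lvec" where
  "Imv w = (\<chi> i. Im (w $ i))"

definition cnjv :: "lvecC \<Rightarrow> lvecC" where
  "cnjv w = (\<chi> i. cnj (w $ i))"

text \<open>Complex linear extension of a real linear map.\<close>

definition complexify :: "(lvec \<Rightarrow> lvec) \<Rightarrow> lvecC \<Rightarrow> lvecC" where
  "complexify F w = cvec (F (Rev w)) + \<i> *s cvec (F (Imv w))"


section \<open>The torus\<close>

text \<open>
  The holomorphic coordinate \<open>z\<close> identifies the universal cover of \<open>M\<close> with \<open>\<complex>\<close>, and the deck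
  transformations, which preserve \<open>\<partial>\<^sub>z\<close>, with the translations by a lattice
  \<open>\<int>\<omega>\<^sub>1 + \<int>\<omega>\<^sub>2\<close>. Thus \<open>M = \<complex> / (\<int>\<omega>\<^sub>1 + \<int>\<omega>\<^sub>2)\<close>, maps on \<open>M\<close> are periodic maps on \<open>\<complex>\<close>, and an
  integral over \<open>M\<close> is an integral over a fundamental parallelogram.
\<close>

definition lattice_basis :: "complex \<Rightarrow> complex \<Rightarrow> bool" where
  "lattice_basis \<omega>1 \<omega>2 \<longleftrightarrow> \<omega>1 \<noteq> 0 \<and> Im (\<omega>2 / \<omega>1) \<noteq> 0"

definition periodic :: "complex \<Rightarrow> complex \<Rightarrow> (complex \<Rightarrow> 'b) \<Rightarrow> bool" where
  "periodic \<omega>1 \<omega>2 g \<longleftrightarrow> (\<forall>p. g (p + \<omega>1) = g p \<and> g (p + \<omega>2) = g p)"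

definition period_cell :: "complex \<Rightarrow> complex \<Rightarrow> complex set" where
  "period_cell \<omega>1 \<omega>2 =
     {of_real r * \<omega>1 + of_real s * \<omega>2 | r s. r \<in> {0..<1::real} \<and> s \<in> {0..<1::real}}"

definition torus_integral :: "complex \<Rightarrow> complex \<Rightarrow> (complex \<Rightarrow> complex) \<Rightarrow> complex" where
  "torus_integral \<omega>1 \<omega>2 g = set_lebesgue_integral lborel (period_cell \<omega>1 \<omega>2) g"

definition d_z :: "(complex \<Rightarrow> complex) \<Rightarrow> complex \<Rightarrow> complex" where
  "d_z g p = (frechet_derivative g (at p) 1 - \<i> * frechet_derivative g (at p) \<i>) / 2"

definition d_zbar :: "(complex \<Rightarrow> complex) \<Rightarrow> complex \<Rightarrow> complex" where
  "d_zbar g p = (frechet_derivative g (at p) 1 + \<i> * frechet_derivative g (at p) \<i>) / 2"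

definition dv_z :: "(complex \<Rightarrow> lvecC) \<Rightarrow> complex \<Rightarrow> lvecC" where
  "dv_z g p = (\<chi> i. d_z (\<lambda>q. g q $ i) p)"

definition dv_zbar :: "(complex \<Rightarrow> lvecC) \<Rightarrow> complex \<Rightarrow> lvecC" where
  "dv_zbar g p = (\<chi> i. d_zbar (\<lambda>q. g q $ i) p)"


section \<open>Conformal immersions into the 4-sphere and their normalized lifts\<close>

definition conformal_immersion :: "complex \<Rightarrow> complex \<Rightarrow> (complex \<Rightarrow> real ^ 5) \<Rightarrow> bool" where
  "conformal_immersion \<omega>1 \<omega>2 f \<longleftrightarrow>
     periodic \<omega>1 \<omega>2 f \<and> smooth_on UNIV f \<and> (\<forall>p. norm (f p) = 1) \<and>
     (\<forall>p. \<exists>r>0. \<forall>v. norm (frechet_derivative f (at p) v) = r * norm v)"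

definition normalized_lift ::
  "complex \<Rightarrow> complex \<Rightarrow> (complex \<Rightarrow> real ^ 5) \<Rightarrow> (complex \<Rightarrow> lvec) \<Rightarrow> bool" where
  "normalized_lift \<omega>1 \<omega>2 f \<psi> \<longleftrightarrow>
     periodic \<omega>1 \<omega>2 \<psi> \<and> smooth_on UNIV \<psi> \<and>
     (\<forall>p. \<psi> p \<in> forward_cone \<and> span {\<psi> p} = span {null_rep (f p)}) \<and>
     (\<forall>p v. lorentz (frechet_derivative \<psi> (at p) v) (frechet_derivative \<psi> (at p) v) = (norm v)\<^sup>2)"


section \<open>The splitting \<open>V \<oplus> V\<^sup>\<bottom>\<close>, the normal connection and the rotation\<close>

text \<open>The fibre of \<open>V\<close> at \<open>p\<close>; note that \<open>\<partial>\<^sub>z\<partial>\<^sub>z\<^sub>b\<^sub>a\<^sub>r \<psi>\<close> is a real vector.\<close>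

definition V_fibre :: "(complex \<Rightarrow> lvec) \<Rightarrow> complex \<Rightarrow> lvec set" where
  "V_fibre \<psi> p =
     span ({\<psi> p} \<union> range (frechet_derivative \<psi> (at p)) \<union>
           {Rev (dv_zbar (dv_z (\<lambda>q. cvec (\<psi> q))) p)})"

definition N_fibre :: "(complex \<Rightarrow> lvec) \<Rightarrow> complex \<Rightarrow> lvec set" where
  "N_fibre \<psi> p = {n. \<forall>v\<in>V_fibre \<psi> p. lorentz v n = 0}"

definition N_fibreC :: "(complex \<Rightarrow> lvec) \<Rightarrow> complex \<Rightarrow> lvecC set" where
  "N_fibreC \<psi> p = {w. Rev w \<in> N_fibre \<psi> p \<and> Imv w \<in> N_fibre \<psi> p}"

text \<open>
  The orthogonal projection onto \<open>V\<^sup>\<bottom>\<close>. It is well defined for a normalized lift, because then the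
  Lorentz form is nondegenerate on \<open>V\<close>.
\<close>

definition N_proj :: "(complex \<Rightarrow> lvec) \<Rightarrow> complex \<Rightarrow> lvec \<Rightarrow> lvec" where
  "N_proj \<psi> p w = (THE n. n \<in> N_fibre \<psi> p \<and> w - n \<in> V_fibre \<psi> p)"

definition D_z :: "(complex \<Rightarrow> lvec) \<Rightarrow> (complex \<Rightarrow> lvecC) \<Rightarrow> complex \<Rightarrow> lvecC" where
  "D_z \<psi> \<xi> p = complexify (N_proj \<psi> p) (dv_z \<xi> p)"

definition D_t ::
  "(real \<Rightarrow> complex \<Rightarrow> lvec) \<Rightarrow> (real \<Rightarrow> complex \<Rightarrow> lvecC) \<Rightarrow> real \<Rightarrow> complex \<Rightarrow> lvecC" where
  "D_t \<psi> \<xi> t p = complexify (N_proj (\<psi> t) p) (vector_derivative (\<lambda>s. \<xi> s p) (at t))"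

text \<open>
  An orientation of the Euclidean rank 2 bundle \<open>V\<^sup>\<bottom>\<close> over \<open>T \<times> M\<close> is the same thing as a continuous
  field of rotations by 90 degrees in its fibres, so quantifying over such fields covers both
  orientations. Only the restriction of \<open>J t p\<close> to the fibre of \<open>V\<^sup>\<bottom>\<close> matters; it is composed with
  the projection to express continuity.
\<close>

definition normal_rotation ::
  "complex \<Rightarrow> complex \<Rightarrow> real set \<Rightarrow> (real \<Rightarrow> complex \<Rightarrow> lvec) \<Rightarrow>
    (real \<Rightarrow> complex \<Rightarrow> lvec \<Rightarrow> lvec) \<Rightarrow> bool" where
  "normal_rotation \<omega>1 \<omega>2 T \<psi> J \<longleftrightarrow>
     (\<forall>t\<in>T. \<forall>p. linear (J t p)) \<and>
     (\<forall>t\<in>T. \<forall>p. \<forall>n\<in>N_fibre (\<psi> t) p.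
        J t p n \<in> N_fibre (\<psi> t) p \<and> lorentz (J t p n) (J t p n) = lorentz n n \<and>
        lorentz n (J t p n) = 0) \<and>
     (\<forall>t\<in>T. \<forall>w. periodic \<omega>1 \<omega>2 (\<lambda>p. J t p (N_proj (\<psi> t) p w))) \<and>
     (\<forall>w. continuous_on (T \<times> UNIV) (\<lambda>(t, p). J t p (N_proj (\<psi> t) p w)))"


section \<open>Schwarzian derivative, Hopf differential and normal variation\<close>

text \<open>
  The conditions below determine \<open>c\<close>, \<open>\<kappa>\<close> and \<open>a\<close>, \<open>b\<close>, \<open>\<sigma>\<close> uniquely from the normalized lift(s),
  so that the periodicity and smoothness of these functions need not be required separately.
\<close>

definition schwarzian_hopf ::
  "(complex \<Rightarrow> lvec) \<Rightarrow> (complex \<Rightarrow> complex) \<Rightarrow> (complex \<Rightarrow> lvecC) \<Rightarrow> bool" where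
  "schwarzian_hopf \<psi> c \<kappa> \<longleftrightarrow>
     (\<forall>p. \<kappa> p \<in> N_fibreC \<psi> p \<and>
          dv_z (dv_z (\<lambda>q. cvec (\<psi> q))) p + (c p / 2) *s cvec (\<psi> p) = \<kappa> p)"

definition isothermic :: "(complex \<Rightarrow> lvecC) \<Rightarrow> bool" where
  "isothermic \<kappa> \<longleftrightarrow> (\<forall>p. \<kappa> p = cnjv (\<kappa> p))"

definition variation_components ::
  "(real \<Rightarrow> complex \<Rightarrow> lvec) \<Rightarrow> real \<Rightarrow> (complex \<Rightarrow> real) \<Rightarrow> (complex \<Rightarrow> complex) \<Rightarrow>
    (complex \<Rightarrow> lvec) \<Rightarrow> bool" where
  "variation_components \<psi> t a b \<sigma> \<longleftrightarrow>
     (\<forall>p. \<sigma> p \<in> N_fibre (\<psi> t) p \<and>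
          cvec (vector_derivative (\<lambda>s. \<psi> s p) (at t)) =
            of_real (a p) *s cvec (\<psi> t p) + b p *s dv_z (\<lambda>q. cvec (\<psi> t q)) p
            + cnj (b p) *s dv_zbar (\<lambda>q. cvec (\<psi> t q)) p + cvec (\<sigma> p))"

end

theory Submission
  imports Defs "HOL-Complex_Analysis.Cauchy_Integral_Formula"
begin

text \<open>
  Write \<open>\<langle>\<cdot>,\<cdot>\<rangle>\<close> for the complex bilinear Lorentz form and \<open>P\<close> for the orthogonal projection onto
  \<open>V\<^sup>\<bottom>\<close>. In terms of the frame \<open>\<psi>, \<psi>\<^sub>z, \<psi>\<^sub>z\<^sub>b\<^sub>a\<^sub>r, \<psi>\<^sub>z\<^sub>z\<^sub>b\<^sub>a\<^sub>r\<close> of \<open>V\<close>, whose Gram matrix is constant up to the entry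
  \<open>\<langle>\<psi>\<^sub>z\<^sub>z\<^sub>b\<^sub>a\<^sub>r, \<psi>\<^sub>z\<^sub>z\<^sub>b\<^sub>a\<^sub>r\<rangle>\<close>, the projection is an explicit formula, smooth in the point (\<open>N_proj_eq\<close>,
  \<open>complexify_N_proj\<close>). The family of lifts is smooth in \<open>(t, p)\<close> jointly, because
  \<open>\<psi> = |f\<^sub>x|\<^sup>-\<^sup>1 (1, f)\<close> (\<open>normalized_lifts_smooth\<close>), so derivatives in \<open>t\<close> and in \<open>z\<close> commute.

  At the isothermic time \<open>\<kappa>\<close> is real, so \<open>\<sigma> = J\<kappa>\<close> is orthogonal to \<open>\<kappa>\<close>. Differentiating
  \<open>\<langle>\<psi>\<^sub>z, \<psi>\<^sub>z\<rangle> = 0\<close> in time gives \<open>\<partial>\<^sub>z(cnj b) = 2\<langle>\<sigma>, \<kappa>\<rangle> = 0\<close>: the function \<open>b\<close> is holomorphic on the torus,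
  hence constant by Liouville, hence zero by its mean (\<open>holomorphic_torus_zero_mean\<close>). Differentiating
  \<open>\<langle>\<psi>\<^sub>z, \<psi>\<^sub>z\<^sub>b\<^sub>a\<^sub>r\<rangle> = 1/2\<close> then gives \<open>a = 0\<close>, so that \<open>\<psi>\<^sub>t = J\<kappa>\<close>.

  Now differentiate \<open>\<kappa> = \<psi>\<^sub>z\<^sub>z + (c/2)\<psi>\<close> in time and project: \<open>D\<^sub>t\<kappa> = P((J\<kappa>)\<^sub>z\<^sub>z) + (c/2)J\<kappa>\<close>. For every
  normal section \<open>\<xi>\<close> the tangential part of \<open>\<xi>\<^sub>z\<close> lies in the span of \<open>\<psi>\<close> and \<open>\<psi>\<^sub>z\<^sub>b\<^sub>a\<^sub>r\<close>, whose
  \<open>z\<close>-derivatives are tangential again, so \<open>P(\<xi>\<^sub>z\<^sub>z) = D\<^sub>zD\<^sub>z\<xi>\<close> (\<open>normal_second_derivative\<close>). Since \<open>J\<close> is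
  parallel (\<open>J_second_derivative\<close>), the evolution equation follows. Finally \<open>D\<^sub>zD\<^sub>z\<kappa> + (c/2)\<kappa>\<close> is real:
  this is the Codazzi equation for a real Hopf differential, a consequence of the symmetry of
  \<open>\<psi>\<^sub>z\<^sub>z\<^sub>z\<^sub>b\<^sub>a\<^sub>r\<^sub>z\<^sub>b\<^sub>a\<^sub>r\<close> (\<open>real_hopf_codazzi\<close>).
\<close>

section \<open>Directional derivatives of smooth maps\<close>

definition dird :: "'a::real_normed_vector \<Rightarrow> ('a \<Rightarrow> 'b::real_normed_vector) \<Rightarrow> 'a \<Rightarrow> 'b" where
  "dird v g x = frechet_derivative g (at x) v"

lemma dird_eqI: "(g has_derivative g') (at x) \<Longrightarrow> dird v g x = g' v"
  unfolding dird_def by (metis frechet_derivative_at)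

lemma Ck_on_Suc: "Ck_on (Suc k) S g \<longleftrightarrow>
    (\<forall>x\<in>S. g differentiable (at x)) \<and> (\<forall>v. Ck_on k S (dird v g))"
  by (simp add: dird_def[abs_def])

declare Ck_on.simps(2) [simp del]

lemma Ck_on_has_derivative:
  "Ck_on (Suc k) S g \<Longrightarrow> x \<in> S \<Longrightarrow> (g has_derivative (\<lambda>v. dird v g x)) (at x)"
  unfolding dird_def by (metis Ck_on_Suc eta_contract_eq frechet_derivative_works)

lemma dird_const: "dird v (\<lambda>x. c) = (\<lambda>x. 0)"
  by (simp add: dird_def fun_eq_iff)

lemma dird_cong_open:
  assumes "open S" "\<And>x. x \<in> S \<Longrightarrow> g x = h x" "x \<in> S"
  shows "dird v g x = dird v h x"
proof -
  have "(g has_derivative D) (at x) \<longleftrightarrow> (h has_derivative D) (at x)" for D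
    using assms has_derivative_transform_within_open[of g D x UNIV S h]
      has_derivative_transform_within_open[of h D x UNIV S g] by auto
  then show ?thesis unfolding dird_def frechet_derivative_def by simp
qed

lemma Ck_on_cong:
  assumes "open S" "\<And>x. x \<in> S \<Longrightarrow> g x = h x" "Ck_on k S g"
  shows "Ck_on k S h"
  using assms(2,3)
proof (induction k arbitrary: g h)
  case 0
  then show ?case by (simp cong: continuous_on_cong)
next
  case (Suc k)
  have "h differentiable (at x)" if "x \<in> S" for x
    using Suc.prems that assms(1) has_derivative_transform_within_open[of g _ x UNIV S h]
    unfolding Ck_on_Suc differentiable_def by blast
  moreover have "Ck_on k S (dird v h)" for v
  proof (rule Suc.IH)
    show "dird v g x = dird v h x" if "x \<in> S" for x
      by (rule dird_cong_open[OF assms(1) Suc.prems(1) that])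
    show "Ck_on k S (dird v g)" using Suc.prems(2) by (simp add: Ck_on_Suc del: Ck_on.simps)
  qed
  ultimately show ?case by (simp add: Ck_on_Suc)
qed

lemma Ck_on_SucD: "Ck_on (Suc k) S g \<Longrightarrow> Ck_on k S g"
proof (induction k arbitrary: g)
  case 0
  then show ?case
    by (auto simp: Ck_on_Suc intro!: differentiable_imp_continuous_on
        simp: differentiable_on_def differentiable_at_withinI)
next
  case (Suc k)
  then show ?case by (meson Ck_on_Suc)
qed

lemma Ck_on_const: "Ck_on k S (\<lambda>x. c)"
proof (induction k arbitrary: c)
  case (Suc k)
  then show ?case by (simp add: Ck_on_Suc dird_const)
qed simp

lemma Ck_on_bounded_linear:
  assumes "open S" "bounded_linear L" "Ck_on k S g"
  shows "Ck_on k S (\<lambda>x. L (g x))"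
  using assms(3)
proof (induction k arbitrary: g)
  case 0
  then show ?case using assms(2) by (simp add: bounded_linear.continuous_on)
next
  case (Suc k)
  have der: "((\<lambda>x. L (g x)) has_derivative (\<lambda>v. L (dird v g x))) (at x)" if "x \<in> S" for x
    using bounded_linear.has_derivative[OF assms(2) Ck_on_has_derivative[OF Suc.prems that]] .
  have "Ck_on k S (dird v (\<lambda>x. L (g x)))" for v
    by (rule Ck_on_cong[OF assms(1), where g="\<lambda>x. L (dird v g x)"])
      (use Suc in \<open>auto simp: Ck_on_Suc intro!: dird_eqI[symmetric] der\<close>)
  then show ?case using der by (auto simp: Ck_on_Suc differentiable_def)
qed

lemma Ck_on_add:
  assumes "open S" "Ck_on k S g" "Ck_on k S h"
  shows "Ck_on k S (\<lambda>x. g x + h x)"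
  using assms(2,3)
proof (induction k arbitrary: g h)
  case 0
  then show ?case by (simp add: continuous_on_add)
next
  case (Suc k)
  have der: "((\<lambda>x. g x + h x) has_derivative (\<lambda>v. dird v g x + dird v h x)) (at x)" if "x \<in> S" for x
    using Suc.prems that by (intro has_derivative_add Ck_on_has_derivative)
  have "Ck_on k S (dird v (\<lambda>x. g x + h x))" for v
    by (rule Ck_on_cong[OF assms(1), where g="\<lambda>x. dird v g x + dird v h x"])
      (use Suc in \<open>auto simp: Ck_on_Suc intro!: dird_eqI[symmetric] der\<close>)
  then show ?case using der by (auto simp: Ck_on_Suc differentiable_def)
qed

text \<open>
  One lemma serves products, scalings and inner products alike. The product rule lowers the order by
  one in either factor only, so \<open>Ck_on_SucD\<close> supplies the other factor.
\<close>

lemma Ck_on_bilinear: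
  assumes "open S" "bounded_bilinear m" "Ck_on k S g" "Ck_on k S h"
  shows "Ck_on k S (\<lambda>x. m (g x) (h x))"
  using assms(3,4)
proof (induction k arbitrary: g h)
  case 0
  then show ?case by (simp add: bounded_bilinear.continuous_on[OF assms(2)])
next
  case (Suc k)
  have der: "((\<lambda>x. m (g x) (h x)) has_derivative
      (\<lambda>v. m (g x) (dird v h x) + m (dird v g x) (h x))) (at x)" if "x \<in> S" for x
    using Suc.prems that by (intro bounded_bilinear.FDERIV[OF assms(2)] Ck_on_has_derivative)
  have "Ck_on k S (dird v (\<lambda>x. m (g x) (h x)))" for v
    by (rule Ck_on_cong[OF assms(1),
          where g="\<lambda>x. m (g x) (dird v h x) + m (dird v g x) (h x)"])
      (use Suc Ck_on_SucD[OF Suc.prems(1)] Ck_on_SucD[OF Suc.prems(2)] in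
        \<open>auto simp: Ck_on_Suc intro!: dird_eqI[symmetric] der Ck_on_add[OF assms(1)]\<close>)
  then show ?case using der by (auto simp: Ck_on_Suc differentiable_def)
qed

text \<open>
  The exponent stays arbitrary in the induction, since differentiation changes it to \<open>r - 1\<close>.
\<close>

lemma Ck_on_powr:
  fixes g :: "'a::euclidean_space \<Rightarrow> real"
  assumes "open S" "\<And>x. x \<in> S \<Longrightarrow> g x > 0" "Ck_on k S g"
  shows "Ck_on k S (\<lambda>x. g x powr r)"
  using assms(3)
proof (induction k arbitrary: r)
  case 0
  then show ?case
    using assms(2) by (auto intro!: continuous_on_powr continuous_on_const simp: less_imp_neq[symmetric])
next
  case (Suc k)
  have der: "((\<lambda>x. g x powr r) has_derivative
      (\<lambda>v. r * (g x powr (r - 1) * dird v g x))) (at x)" if "x \<in> S" for x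
  proof -
    have "(g has_derivative (\<lambda>v. dird v g x)) (at x)"
      by (rule Ck_on_has_derivative[OF Suc.prems that])
    moreover have "((\<lambda>u. u powr r) has_derivative (*) (r * g x powr (r - 1))) (at (g x))"
      using has_real_derivative_powr[OF assms(2)[OF that], of r]
      by (simp add: has_field_derivative_def)
    ultimately show ?thesis
      by (rule has_derivative_eq_rhs[OF has_derivative_compose]) (auto simp: fun_eq_iff)
  qed
  have "Ck_on k S (dird v (\<lambda>x. g x powr r))" for v
    by (rule Ck_on_cong[OF assms(1), where g="\<lambda>x. r * (g x powr (r - 1) * dird v g x)"])
      (use Suc Ck_on_SucD[OF Suc.prems(1)] in
        \<open>auto simp: Ck_on_Suc intro!: dird_eqI[symmetric] der
           Ck_on_bilinear[OF assms(1) bounded_bilinear_mult] Ck_on_const\<close>)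
  then show ?case using der by (auto simp: Ck_on_Suc differentiable_def)
qed

lemma smooth_on_dird: "smooth_on S g \<Longrightarrow> smooth_on S (dird v g)"
  unfolding smooth_on_def by (metis Ck_on_Suc)

lemma smooth_on_has_derivative:
  "smooth_on S g \<Longrightarrow> x \<in> S \<Longrightarrow> (g has_derivative (\<lambda>v. dird v g x)) (at x)"
  unfolding smooth_on_def by (blast intro: Ck_on_has_derivative)

lemma smooth_on_continuous: "smooth_on S g \<Longrightarrow> continuous_on S g"
  unfolding smooth_on_def by (metis Ck_on.simps(1))

lemma smooth_on_const: "smooth_on S (\<lambda>x. c)"
  by (simp add: smooth_on_def Ck_on_const)

lemma smooth_on_cong:
  "open S \<Longrightarrow> (\<And>x. x \<in> S \<Longrightarrow> g x = h x) \<Longrightarrow> smooth_on S g \<Longrightarrow> smooth_on S h"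
  unfolding smooth_on_def using Ck_on_cong by blast

lemma smooth_on_bounded_linear:
  "open S \<Longrightarrow> bounded_linear L \<Longrightarrow> smooth_on S g \<Longrightarrow> smooth_on S (\<lambda>x. L (g x))"
  unfolding smooth_on_def using Ck_on_bounded_linear by blast

lemma smooth_on_add:
  "open S \<Longrightarrow> smooth_on S g \<Longrightarrow> smooth_on S h \<Longrightarrow> smooth_on S (\<lambda>x. g x + h x)"
  unfolding smooth_on_def using Ck_on_add by blast

lemma smooth_on_bilinear:
  "open S \<Longrightarrow> bounded_bilinear m \<Longrightarrow> smooth_on S g \<Longrightarrow> smooth_on S h \<Longrightarrow>
   smooth_on S (\<lambda>x. m (g x) (h x))"
  unfolding smooth_on_def using Ck_on_bilinear by blast

lemma smooth_on_powr:
  fixes g :: "'a::euclidean_space \<Rightarrow> real"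
  shows "open S \<Longrightarrow> (\<And>x. x \<in> S \<Longrightarrow> g x > 0) \<Longrightarrow> smooth_on S g \<Longrightarrow>
   smooth_on S (\<lambda>x. g x powr r)"
  unfolding smooth_on_def using Ck_on_powr by blast

text \<open>
  Smoothness of a family in time and space jointly is what makes mixed derivatives available; these
  facts recover from it the derivatives in the space direction at a fixed time and in the time
  direction at a fixed point.
\<close>

lemma smooth_on_slice:
  fixes h :: "real \<Rightarrow> 'c::euclidean_space \<Rightarrow> 'b::real_normed_vector"
  assumes "open T" "smooth_on (T \<times> UNIV) (\<lambda>(s, p). h s p)" "s \<in> T"
  shows "smooth_on UNIV (h s)"
    and "dird v (h s) p = dird (0, v) (\<lambda>(s, p). h s p) (s, p)"
    and "((\<lambda>s. h s p) has_vector_derivative dird (1, 0) (\<lambda>(s, p). h s p) (s, p)) (at s)"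
proof -
  have der: "(h s has_derivative (\<lambda>v. dird (0, v) (\<lambda>(s, p). h s p) (s, p))) (at p)"
    if "smooth_on (T \<times> UNIV) (\<lambda>(s, p). h s p) \<or> Ck_on (Suc k) (T \<times> UNIV) (\<lambda>(s, p). h s p)"
    for h :: "real \<Rightarrow> 'c \<Rightarrow> 'b" and p k
  proof -
    have "((\<lambda>(s, p). h s p) has_derivative (\<lambda>v. dird v (\<lambda>(s, p). h s p) (s, p))) (at (s, p))"
      using that smooth_on_has_derivative[of "T \<times> UNIV" "\<lambda>(s, p). h s p" "(s, p)"]
        Ck_on_has_derivative[of k "T \<times> UNIV" "\<lambda>(s, p). h s p" "(s, p)"] assms(3) by auto
    moreover have "((\<lambda>p. (s, p)) has_derivative (\<lambda>v. (0, v))) (at p)"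
      by (intro has_derivative_Pair has_derivative_const has_derivative_ident)
    ultimately show ?thesis using has_derivative_compose by fastforce
  qed
  show "dird v (h s) p = dird (0, v) (\<lambda>(s, p). h s p) (s, p)"
    by (rule dird_eqI[OF der]) (use assms in blast)
  have "Ck_on k (T \<times> UNIV) (\<lambda>(s, p). h s p) \<Longrightarrow> Ck_on k UNIV (h s)" for k and h :: "real \<Rightarrow> 'c \<Rightarrow> 'b"
  proof (induction k arbitrary: h)
    case 0
    have "continuous_on UNIV ((\<lambda>(s, p). h s p) \<circ> (\<lambda>p. (s, p)))"
      using 0 assms(3)
      by (intro continuous_on_compose) (auto intro!: continuous_intros intro: continuous_on_subset)
    then show ?case by (simp add: o_def)
  next
    case (Suc k)
    have "Ck_on k UNIV (\<lambda>p. dird (0, v) (\<lambda>(s, p). h s p) (s, p))" for v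
      using Suc.prems by (intro Suc.IH) (auto simp: Ck_on_Suc)
    moreover have "dird v (h s) = (\<lambda>p. dird (0, v) (\<lambda>(s, p). h s p) (s, p))" for v
      using dird_eqI[OF der] Suc.prems by blast
    moreover have "h s differentiable (at p)" for p
      using der[of h k p] Suc.prems unfolding differentiable_def by blast
    ultimately show ?case by (simp add: Ck_on_Suc)
  qed
  then show "smooth_on UNIV (h s)"
    using assms(2) by (auto simp: smooth_on_def)
  have "((\<lambda>(s, p). h s p) has_derivative (\<lambda>v. dird v (\<lambda>(s, p). h s p) (s, p))) (at (s, p))"
    using smooth_on_has_derivative[OF assms(2)] assms(3) by blast
  moreover have "((\<lambda>s. (s, p)) has_derivative (\<lambda>r. (r, 0))) (at s)"
    by (intro has_derivative_Pair has_derivative_const has_derivative_ident)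
  ultimately have "((\<lambda>s. h s p) has_derivative (\<lambda>r. dird (r, 0) (\<lambda>(s, p). h s p) (s, p))) (at s)"
    using has_derivative_compose by fastforce
  moreover have "dird (r, 0) (\<lambda>(s, p). h s p) (s, p) = r *\<^sub>R dird (1, 0) (\<lambda>(s, p). h s p) (s, p)" for r
    using linear_simps(5)[OF has_derivative_bounded_linear[OF smooth_on_has_derivative[OF assms(2)]],
        of "(s, p)" r "(1, 0)"] assms(3) by simp
  ultimately show "((\<lambda>s. h s p) has_vector_derivative dird (1, 0) (\<lambda>(s, p). h s p) (s, p)) (at s)"
    unfolding has_vector_derivative_def by (rule has_derivative_eq_rhs[OF _ ext])
qed

text \<open>
  The second difference over a parallelogram is symmetric in \<open>u\<close> and \<open>v\<close>, while two applications of
  the mean value theorem express it by the iterated derivative in one chosen order. Comparing the two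
  orders on shrinking parallelograms gives the symmetry of second derivatives.
\<close>

lemma second_difference_mvt:
  fixes g :: "'a::euclidean_space \<Rightarrow> real"
  assumes g: "smooth_on S g" and h: "h > 0"
    and S: "\<And>s r. 0 \<le> s \<Longrightarrow> s \<le> h \<Longrightarrow> 0 \<le> r \<Longrightarrow> r \<le> h \<Longrightarrow> x + s *\<^sub>R u + r *\<^sub>R v \<in> S"
  obtains s r where "0 < s" "s < h" "0 < r" "r < h"
    "g (x + h *\<^sub>R u + h *\<^sub>R v) - g (x + h *\<^sub>R u) - g (x + h *\<^sub>R v) + g x
     = h * h * dird v (dird u g) (x + s *\<^sub>R u + r *\<^sub>R v)"
proof -
  have lin: "((\<lambda>s. f (y + s *\<^sub>R w)) has_field_derivative dird w f (y + s *\<^sub>R w)) (at s)"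
    if "smooth_on S f" "y + s *\<^sub>R w \<in> S" for f :: "'a \<Rightarrow> real" and y w s
  proof -
    have *: "(f has_derivative (\<lambda>v. dird v f (y + s *\<^sub>R w))) (at (y + s *\<^sub>R w))"
      using smooth_on_has_derivative[OF that] .
    have "((\<lambda>s. f (y + s *\<^sub>R w)) has_derivative (\<lambda>r. dird (r *\<^sub>R w) f (y + s *\<^sub>R w))) (at s)"
    proof -
      have "((\<lambda>s. y + s *\<^sub>R w) has_derivative (\<lambda>r. r *\<^sub>R w)) (at s)"
        by (auto intro!: derivative_eq_intros)
      from has_derivative_compose[OF this *] show ?thesis .
    qed
    moreover have "dird (r *\<^sub>R w) f (y + s *\<^sub>R w) = dird w f (y + s *\<^sub>R w) * r" for r
      using linear_simps(5)[OF has_derivative_bounded_linear[OF *], of r w] by (simp add: mult.commute)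
    ultimately show ?thesis
      by (simp add: has_field_derivative_def)
  qed
  define F where "F s = g ((x + h *\<^sub>R v) + s *\<^sub>R u) - g (x + s *\<^sub>R u)" for s
  have "(F has_field_derivative dird u g ((x + h *\<^sub>R v) + s *\<^sub>R u) - dird u g (x + s *\<^sub>R u)) (at s)"
    if "0 \<le> s" "s \<le> h" for s
    unfolding F_def using S[of s h] S[of s 0] that h
    by (intro DERIV_diff lin g) (auto simp: algebra_simps)
  from MVT2[OF h this] obtain s where s: "0 < s" "s < h"
    "F h - F 0 = h * (dird u g ((x + h *\<^sub>R v) + s *\<^sub>R u) - dird u g (x + s *\<^sub>R u))" by auto
  have "((\<lambda>r. dird u g ((x + s *\<^sub>R u) + r *\<^sub>R v)) has_field_derivative
      dird v (dird u g) ((x + s *\<^sub>R u) + r *\<^sub>R v)) (at r)"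
    if "0 \<le> r" "r \<le> h" for r
    using S[of s r] that s by (intro lin smooth_on_dird g) auto
  from MVT2[OF h this] obtain r where r: "0 < r" "r < h"
    "dird u g (x + s *\<^sub>R u + h *\<^sub>R v) - dird u g (x + s *\<^sub>R u)
      = h * dird v (dird u g) (x + s *\<^sub>R u + r *\<^sub>R v)" by auto
  show thesis
    by (rule that[OF s(1,2) r(1,2)]) (use s(3) r(3) in \<open>simp add: F_def algebra_simps\<close>)
qed

lemma dird_commute_real:
  fixes g :: "'a::euclidean_space \<Rightarrow> real"
  assumes S: "open S" and g: "smooth_on S g" and x: "x \<in> S"
  shows "dird u (dird v g) x = dird v (dird u g) x"
proof (rule ccontr)
  define A B where "A = dird u (dird v g)" and "B = dird v (dird u g)"
  assume "dird u (dird v g) x \<noteq> dird v (dird u g) x"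
  then have e: "\<bar>A x - B x\<bar> / 2 > 0" (is "?e > 0") by (simp add: A_def B_def)
  have "smooth_on S A" "smooth_on S B"
    unfolding A_def B_def by (intro smooth_on_dird g)+
  then have cont: "isCont A x" "isCont B x"
    using smooth_on_continuous continuous_on_eq_continuous_at[OF S] x by blast+
  obtain d1 where d1: "d1 > 0" "\<And>y. dist y x < d1 \<Longrightarrow> dist (A y) (A x) < ?e"
    using cont(1) e unfolding continuous_at_eps_delta by meson
  obtain d2 where d2: "d2 > 0" "\<And>y. dist y x < d2 \<Longrightarrow> dist (B y) (B x) < ?e"
    using cont(2) e unfolding continuous_at_eps_delta by meson
  obtain d3 where d3: "d3 > 0" "ball x d3 \<subseteq> S" using S x openE by blast
  define d where "d = min d1 (min d2 d3)"
  define h where "h = d / (2 * (norm u + norm v + 1))"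
  have pos: "d > 0" "h > 0" using d1(1) d2(1) d3(1) by (simp_all add: d_def h_def add_nonneg_pos)
  have near: "dist (x + s *\<^sub>R u + r *\<^sub>R v) x < d" if "0 \<le> s" "s \<le> h" "0 \<le> r" "r \<le> h" for s r
  proof -
    have "norm (s *\<^sub>R u + r *\<^sub>R v) \<le> s * norm u + r * norm v"
      using that by (intro norm_triangle_le) auto
    also have "\<dots> \<le> h * norm u + h * norm v"
      using that by (intro add_mono mult_right_mono) auto
    also have "\<dots> \<le> h * (norm u + norm v + 1)" using pos by (simp add: algebra_simps)
    also have "\<dots> = d / 2"
    proof -
      have "norm u + norm v + 1 > 0" by (simp add: add_nonneg_pos)
      then show ?thesis by (simp add: h_def del: distrib_left_numeral)
    qed
    also have "\<dots> < d" using pos by simp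
    finally show ?thesis by (simp add: dist_norm add.assoc)
  qed
  have inS: "x + s *\<^sub>R u + r *\<^sub>R v \<in> S" if "0 \<le> s" "s \<le> h" "0 \<le> r" "r \<le> h" for s r
    using near[OF that] d3 by (auto simp: d_def dist_commute)
  obtain s r where sr: "0 < s" "s < h" "0 < r" "r < h"
    "g (x + h *\<^sub>R u + h *\<^sub>R v) - g (x + h *\<^sub>R u) - g (x + h *\<^sub>R v) + g x
     = h * h * B (x + s *\<^sub>R u + r *\<^sub>R v)"
    unfolding B_def by (rule second_difference_mvt[OF g pos(2), of x u v]) (blast intro: inS)+
  have inS': "x + s *\<^sub>R v + r *\<^sub>R u \<in> S" if "0 \<le> s" "s \<le> h" "0 \<le> r" "r \<le> h" for s r
    using inS[OF that(3,4,1,2)] by (simp add: algebra_simps)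
  obtain s' r' where sr': "0 < s'" "s' < h" "0 < r'" "r' < h"
    "g (x + h *\<^sub>R v + h *\<^sub>R u) - g (x + h *\<^sub>R v) - g (x + h *\<^sub>R u) + g x
     = h * h * A (x + s' *\<^sub>R v + r' *\<^sub>R u)"
    unfolding A_def by (rule second_difference_mvt[OF g pos(2), of x v u]) (blast intro: inS')+
  have "h * h * A (x + s' *\<^sub>R v + r' *\<^sub>R u) = h * h * B (x + s *\<^sub>R u + r *\<^sub>R v)"
    using sr(5) sr'(5) by (auto simp: algebra_simps)
  then have "A (x + r' *\<^sub>R u + s' *\<^sub>R v) = B (x + s *\<^sub>R u + r *\<^sub>R v)"
    using pos by (simp add: algebra_simps)
  moreover have "dist (A (x + r' *\<^sub>R u + s' *\<^sub>R v)) (A x) < ?e"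
    using near[of r' s'] sr' by (intro d1(2)) (simp add: d_def)
  moreover have "dist (B (x + s *\<^sub>R u + r *\<^sub>R v)) (B x) < ?e"
    using near[of s r] sr by (intro d2(2)) (simp add: d_def)
  ultimately show False by (simp add: dist_real_def abs_if split: if_splits)
qed

lemma dird_bounded_linear:
  assumes "bounded_linear L" "smooth_on S g" "x \<in> S"
  shows "dird v (\<lambda>x. L (g x)) x = L (dird v g x)"
  by (rule dird_eqI bounded_linear.has_derivative assms smooth_on_has_derivative)+

lemma dird_commute:
  fixes g :: "'a::euclidean_space \<Rightarrow> 'b::euclidean_space"
  assumes S: "open S" and g: "smooth_on S g" and x: "x \<in> S"
  shows "dird u (dird v g) x = dird v (dird u g) x"
proof (rule euclidean_eqI)
  fix i :: 'b assume "i \<in> Basis"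
  have L: "bounded_linear (\<lambda>y::'b. y \<bullet> i)" by (rule bounded_linear_inner_left)
  have *: "dird u (dird v g) x \<bullet> i = dird u (dird v (\<lambda>x. g x \<bullet> i)) x" for u v
  proof -
    have "dird u (dird v (\<lambda>x. g x \<bullet> i)) x = dird u (\<lambda>x. dird v g x \<bullet> i) x"
      by (rule dird_cong_open[OF S _ x]) (rule dird_bounded_linear[OF L g])
    also have "\<dots> = dird u (dird v g) x \<bullet> i"
      by (rule dird_bounded_linear[OF L smooth_on_dird[OF g] x])
    finally show ?thesis by simp
  qed
  show "dird u (dird v g) x \<bullet> i = dird v (dird u g) x \<bullet> i"
    unfolding * by (intro dird_commute_real[OF S _ x] smooth_on_bounded_linear[OF S L] g)
qed

section \<open>Wirtinger derivatives and the complexified Lorentz form\<close>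

text \<open>
  Both Wirtinger operators at once: \<open>e = -\<i>\<close> gives \<open>\<partial>\<^sub>z\<close> and \<open>e = \<i>\<close> gives \<open>\<partial>\<^sub>z\<^sub>b\<^sub>a\<^sub>r\<close>. Rules proved for
  arbitrary \<open>e\<close> hold for both, and conjugation of a derivative becomes conjugation of \<open>e\<close>.
\<close>

definition wirt :: "complex \<Rightarrow> (complex \<Rightarrow> complex) \<Rightarrow> complex \<Rightarrow> complex" where
  "wirt e g p = (dird 1 g p + e * dird \<i> g p) / 2"

definition wirtv :: "complex \<Rightarrow> (complex \<Rightarrow> lvecC) \<Rightarrow> complex \<Rightarrow> lvecC" where
  "wirtv e g p = (\<chi> i. wirt e (\<lambda>q. g q $ i) p)"

lemma d_z_wirt: "d_z = wirt (- \<i>)"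
  by (simp add: fun_eq_iff d_z_def wirt_def dird_def)

lemma d_zbar_wirt: "d_zbar = wirt \<i>"
  by (simp add: fun_eq_iff d_zbar_def wirt_def dird_def)

lemma dv_z_wirt: "dv_z = wirtv (- \<i>)"
  by (simp add: fun_eq_iff dv_z_def wirtv_def d_z_wirt)

lemma dv_zbar_wirt: "dv_zbar = wirtv \<i>"
  by (simp add: fun_eq_iff dv_zbar_def wirtv_def d_zbar_wirt)

definition vsmooth :: "(complex \<Rightarrow> lvecC) \<Rightarrow> bool" where
  "vsmooth g \<longleftrightarrow> (\<forall>i. smooth_on UNIV (\<lambda>p. g p $ i))"

abbreviation smooth :: "(complex \<Rightarrow> complex) \<Rightarrow> bool" where
  "smooth \<equiv> smooth_on UNIV"

lemma smooth_mult: "open S \<Longrightarrow> smooth_on S g \<Longrightarrow> smooth_on S h \<Longrightarrow> smooth_on S (\<lambda>x. g x * h x)"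
  for g h :: "'a::euclidean_space \<Rightarrow> complex"
  by (rule smooth_on_bilinear[OF _ bounded_bilinear_mult])

lemma smooth_cnj: "open S \<Longrightarrow> smooth_on S g \<Longrightarrow> smooth_on S (\<lambda>x. cnj (g x))"
  by (rule smooth_on_bounded_linear[OF _ bounded_linear_cnj])

lemma smooth_minus: "open S \<Longrightarrow> smooth_on S g \<Longrightarrow> smooth_on S (\<lambda>x. - g x)"
  by (rule smooth_on_bounded_linear[OF _ bounded_linear_minus[OF bounded_linear_ident]])

lemma smooth_sum:
  "finite I \<Longrightarrow> open S \<Longrightarrow> (\<And>i. i \<in> I \<Longrightarrow> smooth_on S (g i)) \<Longrightarrow> smooth_on S (\<lambda>x. \<Sum>i\<in>I. g i x)"
  by (induction I rule: finite_induct) (auto intro: smooth_on_const smooth_on_add)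

lemma dird_add:
  "smooth_on S g \<Longrightarrow> smooth_on S h \<Longrightarrow> x \<in> S \<Longrightarrow>
   dird v (\<lambda>x. g x + h x) x = dird v g x + dird v h x"
  by (rule dird_eqI has_derivative_add smooth_on_has_derivative | assumption)+

lemma dird_mult:
  "smooth_on S g \<Longrightarrow> smooth_on S h \<Longrightarrow> x \<in> S \<Longrightarrow>
   dird v (\<lambda>x. g x * h x) x = g x * dird v h x + dird v g x * h x"
  for g h :: "'a::euclidean_space \<Rightarrow> complex"
  by (rule dird_eqI has_derivative_mult smooth_on_has_derivative | assumption)+

lemma dird_cnj: "smooth_on S g \<Longrightarrow> x \<in> S \<Longrightarrow> dird v (\<lambda>x. cnj (g x)) x = cnj (dird v g x)"
  by (rule dird_bounded_linear[OF bounded_linear_cnj])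

lemma half_sum:
  fixes g h :: "'a::euclidean_space \<Rightarrow> complex"
  assumes "open S" "smooth_on S g" "smooth_on S h"
  shows "smooth_on S (\<lambda>x. (g x + e * h x) / 2)"
    and "x \<in> S \<Longrightarrow> dird v (\<lambda>x. (g x + e * h x) / 2) x = (dird v g x + e * dird v h x) / 2"
proof -
  have "smooth_on S (\<lambda>x. (g x + e * h x) * (1 / 2))"
    by (intro smooth_mult smooth_on_add smooth_on_const assms)
  then show "smooth_on S (\<lambda>x. (g x + e * h x) / 2)" by simp
  assume x: "x \<in> S"
  note d = smooth_on_has_derivative[OF assms(2) x] smooth_on_has_derivative[OF assms(3) x]
  have "((\<lambda>x. (g x + e * h x) / 2) has_derivative (\<lambda>v. (dird v g x + e * dird v h x) / 2)) (at x)"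
    by (auto intro!: derivative_eq_intros d)
  then show "dird v (\<lambda>x. (g x + e * h x) / 2) x = (dird v g x + e * dird v h x) / 2"
    by (rule dird_eqI)
qed

lemma smooth_wirt: "smooth g \<Longrightarrow> smooth (wirt e g)"
  unfolding wirt_def[abs_def] by (intro half_sum(1) smooth_on_dird open_UNIV)

lemma wirt_const: "wirt e (\<lambda>p. c) p = 0"
  by (simp add: wirt_def dird_const)

lemma wirt_add: "smooth g \<Longrightarrow> smooth h \<Longrightarrow> wirt e (\<lambda>p. g p + h p) p = wirt e g p + wirt e h p"
  by (simp add: wirt_def dird_add[of UNIV] field_simps)

lemma wirt_mult:
  "smooth g \<Longrightarrow> smooth h \<Longrightarrow> wirt e (\<lambda>p. g p * h p) p = wirt e g p * h p + g p * wirt e h p"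
  by (simp add: wirt_def dird_mult[of UNIV] field_simps)

lemma wirt_cnj: "smooth g \<Longrightarrow> wirt e (\<lambda>p. cnj (g p)) p = cnj (wirt (cnj e) g p)"
  by (simp add: wirt_def dird_cnj[of UNIV])

lemma wirt_sum:
  "finite I \<Longrightarrow> (\<And>i. i \<in> I \<Longrightarrow> smooth (g i)) \<Longrightarrow> wirt e (\<lambda>p. \<Sum>i\<in>I. g i p) p = (\<Sum>i\<in>I. wirt e (g i) p)"
  by (induction I rule: finite_induct) (simp_all add: wirt_const wirt_add smooth_sum)

lemma wirt_commute:
  assumes g: "smooth g"
  shows "wirt e (wirt e' g) p = wirt e' (wirt e g) p"
proof -
  have "dird v (wirt e g) p = (dird v (dird 1 g) p + e * dird v (dird \<i> g) p) / 2" for v e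
    unfolding wirt_def[abs_def] by (intro half_sum(2)[of UNIV] smooth_on_dird g) auto
  then show ?thesis
    using dird_commute[OF open_UNIV g, of p 1 \<i>] by (simp add: wirt_def[of _ "wirt _ _"] field_simps)
qed

definition lorentzC :: "lvecC \<Rightarrow> lvecC \<Rightarrow> complex" where
  "lorentzC v w = - (v $ None * w $ None) + (\<Sum>k\<in>UNIV. v $ Some k * w $ Some k)"

lemma lorentzC_commute: "lorentzC v w = lorentzC w v"
  by (simp add: lorentzC_def mult.commute)

lemma lorentzC_linear [simp]:
  "lorentzC (v + v') w = lorentzC v w + lorentzC v' w"
  "lorentzC (v - v') w = lorentzC v w - lorentzC v' w"
  "lorentzC (a *s v) w = a * lorentzC v w"
  "lorentzC w (v + v') = lorentzC w v + lorentzC w v'"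
  "lorentzC w (v - v') = lorentzC w v - lorentzC w v'"
  "lorentzC w (a *s v) = a * lorentzC w v"
  by (simp_all add: lorentzC_def sum.distrib sum_subtractf sum_distrib_left algebra_simps)

lemma lorentzC_cnjv: "lorentzC (cnjv v) (cnjv w) = cnj (lorentzC v w)"
  by (simp add: lorentzC_def cnjv_def)

lemma lorentzC_cvec: "lorentzC (cvec v) (cvec w) = of_real (lorentz v w)"
  by (simp add: lorentzC_def lorentz_def cvec_def)

lemma cnjv_simps [simp]:
  "cnjv (v + w) = cnjv v + cnjv w" "cnjv (v - w) = cnjv v - cnjv w" "cnjv (a *s v) = cnj a *s cnjv v"
  "cnjv (cvec u) = cvec u" "cnjv (cnjv v) = v"
  by (simp_all add: vec_eq_iff cnjv_def cvec_def)

lemma vsmooth_add: "vsmooth g \<Longrightarrow> vsmooth h \<Longrightarrow> vsmooth (\<lambda>p. g p + h p)"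
  by (simp add: vsmooth_def smooth_on_add)

lemma vsmooth_scale: "smooth f \<Longrightarrow> vsmooth g \<Longrightarrow> vsmooth (\<lambda>p. f p *s g p)"
  by (simp add: vsmooth_def smooth_mult)

lemma vsmooth_diff: "vsmooth g \<Longrightarrow> vsmooth h \<Longrightarrow> vsmooth (\<lambda>p. g p - h p)"
  using vsmooth_add[of g "\<lambda>p. (- 1) *s h p"] vsmooth_scale[of "\<lambda>p. - 1" h]
  by (simp add: smooth_on_const)

lemma vsmooth_wirtv: "vsmooth g \<Longrightarrow> vsmooth (wirtv e g)"
  by (simp add: vsmooth_def wirtv_def smooth_wirt)

lemma smooth_lorentzC: "vsmooth g \<Longrightarrow> vsmooth h \<Longrightarrow> smooth (\<lambda>p. lorentzC (g p) (h p))"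
  unfolding lorentzC_def vsmooth_def
  by (intro smooth_on_add smooth_minus smooth_sum smooth_mult) auto

lemma wirtv_add: "vsmooth g \<Longrightarrow> vsmooth h \<Longrightarrow> wirtv e (\<lambda>p. g p + h p) p = wirtv e g p + wirtv e h p"
  by (simp add: vec_eq_iff wirtv_def vsmooth_def wirt_add)

lemma wirtv_scale:
  "smooth f \<Longrightarrow> vsmooth g \<Longrightarrow> wirtv e (\<lambda>p. f p *s g p) p = wirt e f p *s g p + f p *s wirtv e g p"
  by (simp add: vec_eq_iff wirtv_def vsmooth_def wirt_mult)

lemma wirtv_cnjv: "vsmooth g \<Longrightarrow> wirtv e (\<lambda>p. cnjv (g p)) p = cnjv (wirtv (cnj e) g p)"
  by (simp add: vec_eq_iff wirtv_def vsmooth_def cnjv_def wirt_cnj)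

lemma wirtv_commute: "vsmooth g \<Longrightarrow> wirtv e (wirtv e' g) p = wirtv e' (wirtv e g) p"
  by (simp add: vec_eq_iff wirtv_def vsmooth_def wirt_commute)

lemma wirt_lorentzC:
  assumes "vsmooth g" "vsmooth h"
  shows "wirt e (\<lambda>p. lorentzC (g p) (h p)) p = lorentzC (wirtv e g p) (h p) + lorentzC (g p) (wirtv e h p)"
proof -
  have s: "smooth (\<lambda>p. g p $ i)" "smooth (\<lambda>p. h p $ i)" for i
    using assms by (auto simp: vsmooth_def)
  have "(\<lambda>p. lorentzC (g p) (h p)) =
      (\<lambda>p. (- 1) * (g p $ None * h p $ None) + (\<Sum>k\<in>UNIV. g p $ Some k * h p $ Some k))"
    by (simp add: lorentzC_def)
  then have "wirt e (\<lambda>p. lorentzC (g p) (h p)) p =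
     - (wirt e (\<lambda>p. g p $ None) p * h p $ None + g p $ None * wirt e (\<lambda>p. h p $ None) p) +
     (\<Sum>k\<in>UNIV. wirt e (\<lambda>p. g p $ Some k) p * h p $ Some k + g p $ Some k * wirt e (\<lambda>p. h p $ Some k) p)"
    by (simp only: wirt_add wirt_mult wirt_sum wirt_const s smooth_on_const smooth_sum smooth_mult
        finite open_UNIV) simp
  then show ?thesis
    by (simp add: lorentzC_def wirtv_def sum.distrib)
qed


section \<open>Smooth families of maps\<close>

definition jsmooth :: "real set \<Rightarrow> (real \<Rightarrow> complex \<Rightarrow> 'b::real_normed_vector) \<Rightarrow> bool" where
  "jsmooth T h \<longleftrightarrow> smooth_on (T \<times> UNIV) (\<lambda>(s, p). h s p)"

definition d_t :: "(real \<Rightarrow> complex \<Rightarrow> 'b::real_normed_vector) \<Rightarrow> real \<Rightarrow> complex \<Rightarrow> 'b" where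
  "d_t h s p = vector_derivative (\<lambda>r. h r p) (at s)"

definition vjsmooth :: "real set \<Rightarrow> (real \<Rightarrow> complex \<Rightarrow> lvecC) \<Rightarrow> bool" where
  "vjsmooth T h \<longleftrightarrow> (\<forall>i. jsmooth T (\<lambda>s p. h s p $ i))"

lemma has_vector_derivative_vec:
  fixes f :: "real \<Rightarrow> 'b::euclidean_space ^ 'n"
  assumes "\<And>i. ((\<lambda>r. f r $ i) has_vector_derivative f' $ i) (at s)"
  shows "(f has_vector_derivative f') (at s)"
proof -
  have "((\<lambda>r. f r \<bullet> b) has_derivative (\<lambda>x. (x *\<^sub>R f') \<bullet> b)) (at s)" if b_Basis: "b \<in> Basis" for b
  proof -
    obtain i u where b: "b = axis i u" using b_Basis unfolding Basis_vec_def by blast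
    have "((\<lambda>r. f r $ i \<bullet> u) has_derivative (\<lambda>x. (x *\<^sub>R f' $ i) \<bullet> u)) (at s)"
      using assms[of i] has_derivative_inner_left unfolding has_vector_derivative_def by blast
    then show ?thesis by (simp add: b inner_axis)
  qed
  then show ?thesis
    unfolding has_vector_derivative_def by (subst has_derivative_componentwise_within) blast
qed

context
  fixes T :: "real set"
  assumes T: "open T"
begin

lemma open_slab: "open (T \<times> (UNIV :: complex set))"
  using T by (simp add: open_Times)

lemma d_t_dird: "jsmooth T h \<Longrightarrow> s \<in> T \<Longrightarrow> d_t h s p = dird (1, 0) (\<lambda>(s, p). h s p) (s, p)"
  unfolding d_t_def jsmooth_def by (rule vector_derivative_at[OF smooth_on_slice(3)[OF T]])

lemma d_t_works: "jsmooth T h \<Longrightarrow> s \<in> T \<Longrightarrow> ((\<lambda>r. h r p) has_vector_derivative d_t h s p) (at s)"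
  using smooth_on_slice(3)[OF T, of h s p] by (simp add: d_t_dird jsmooth_def)

lemma jsmooth_slice: "jsmooth T h \<Longrightarrow> s \<in> T \<Longrightarrow> smooth_on UNIV (h s)"
  unfolding jsmooth_def by (rule smooth_on_slice(1)[OF T])

lemma jsmooth_d_t: "jsmooth T h \<Longrightarrow> jsmooth T (d_t h)"
  unfolding jsmooth_def[of _ "d_t h"]
  by (rule smooth_on_cong[OF open_slab _ smooth_on_dird[of _ "\<lambda>(s, p). h s p" "(1, 0)"]])
    (auto simp: d_t_dird jsmooth_def)

lemma jsmooth_cong:
  "jsmooth T g \<Longrightarrow> (\<And>s p. s \<in> T \<Longrightarrow> g s p = h s p) \<Longrightarrow> jsmooth T h"
  unfolding jsmooth_def by (rule smooth_on_cong[OF open_slab]) auto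

lemma jsmooth_wirt:
  fixes h :: "real \<Rightarrow> complex \<Rightarrow> complex"
  assumes h: "jsmooth T h"
  shows "jsmooth T (\<lambda>s. wirt e (h s))"
    and "s \<in> T \<Longrightarrow> d_t (\<lambda>s. wirt e (h s)) s p = wirt e (d_t h s) p"
proof -
  let ?h = "\<lambda>(s, p). h s p"
  have sm: "smooth_on (T \<times> UNIV) ?h" using h by (simp add: jsmooth_def)
  let ?w = "\<lambda>q. (dird (0, 1) ?h q + e * dird (0, \<i>) ?h q) / 2"
  have w: "wirt e (h s) p = ?w (s, p)" if "s \<in> T" for s p
    by (simp add: wirt_def smooth_on_slice(2)[OF T sm that])
  have smw: "smooth_on (T \<times> UNIV) ?w"
    by (intro half_sum(1) smooth_on_dird sm open_slab)
  show js: "jsmooth T (\<lambda>s. wirt e (h s))"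
    unfolding jsmooth_def by (rule smooth_on_cong[OF open_slab _ smw]) (use w in auto)
  assume s: "s \<in> T"
  then have sp: "(s, p) \<in> T \<times> UNIV" by simp
  have "d_t (\<lambda>s. wirt e (h s)) s p = dird (1, 0) ?w (s, p)"
    unfolding d_t_dird[OF js s]
    by (rule dird_cong_open[OF open_slab _ sp]) (use w in auto)
  also have "\<dots> = (dird (1, 0) (dird (0, 1) ?h) (s, p) + e * dird (1, 0) (dird (0, \<i>) ?h) (s, p)) / 2"
    by (intro half_sum(2)[OF open_slab] smooth_on_dird sm sp)
  also have "\<dots> = (dird (0, 1) (dird (1, 0) ?h) (s, p) + e * dird (0, \<i>) (dird (1, 0) ?h) (s, p)) / 2"
    using dird_commute[OF open_slab sm sp] by simp
  also have "\<dots> = wirt e (d_t h s) p"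
  proof -
    have "dird v (dird (1, 0) ?h) (s, p) = dird v (\<lambda>(s, p). d_t h s p) (s, p)" for v
      by (rule dird_cong_open[OF open_slab _ sp]) (auto simp: d_t_dird[OF h])
    then show ?thesis
      using jsmooth_d_t[OF h] smooth_on_slice(2)[OF T _ s, of "d_t h"]
      by (simp add: wirt_def jsmooth_def)
  qed
  finally show "d_t (\<lambda>s. wirt e (h s)) s p = wirt e (d_t h s) p" .
qed

lemma vjsmooth_d_t_nth:
  assumes "vjsmooth T h" "s \<in> T"
  shows "d_t h s p $ i = d_t (\<lambda>s p. h s p $ i) s p"
    and "((\<lambda>r. h r p) has_vector_derivative d_t h s p) (at s)"
proof -
  have "((\<lambda>r. h r p $ i) has_vector_derivative d_t (\<lambda>s p. h s p $ i) s p) (at s)" for i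
    using assms by (intro d_t_works) (auto simp: vjsmooth_def)
  then have "((\<lambda>r. h r p) has_vector_derivative (\<chi> i. d_t (\<lambda>s p. h s p $ i) s p)) (at s)"
    by (intro has_vector_derivative_vec) simp
  moreover from this have "d_t h s p = (\<chi> i. d_t (\<lambda>s p. h s p $ i) s p)"
    unfolding d_t_def by (rule vector_derivative_at)
  ultimately show "d_t h s p $ i = d_t (\<lambda>s p. h s p $ i) s p"
    "((\<lambda>r. h r p) has_vector_derivative d_t h s p) (at s)" by simp_all
qed

lemma vjsmooth_slice: "vjsmooth T h \<Longrightarrow> s \<in> T \<Longrightarrow> vsmooth (h s)"
  unfolding vjsmooth_def vsmooth_def using jsmooth_slice by fastforce

lemma vjsmooth_d_t:
  assumes "vjsmooth T h"
  shows "vjsmooth T (d_t h)"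
  unfolding vjsmooth_def
proof
  fix i
  have "jsmooth T (\<lambda>s p. h s p $ i)" using assms by (simp add: vjsmooth_def)
  from jsmooth_d_t[OF this] show "jsmooth T (\<lambda>s p. d_t h s p $ i)"
    by (rule jsmooth_cong) (simp add: vjsmooth_d_t_nth(1)[OF assms])
qed

lemma vjsmooth_wirtv:
  assumes "vjsmooth T h"
  shows "vjsmooth T (\<lambda>s. wirtv e (h s))"
    and "s \<in> T \<Longrightarrow> d_t (\<lambda>s. wirtv e (h s)) s p = wirtv e (d_t h s) p"
proof -
  show *: "vjsmooth T (\<lambda>s. wirtv e (h s))"
    using assms by (simp add: vjsmooth_def wirtv_def jsmooth_wirt(1))
  assume s: "s \<in> T"
  have "d_t (\<lambda>s. wirtv e (h s)) s p $ i = wirtv e (d_t h s) p $ i" for i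
  proof -
    have "jsmooth T (\<lambda>s p. h s p $ i)" using assms by (simp add: vjsmooth_def)
    from jsmooth_wirt(2)[OF this s, of e p] show ?thesis
      by (simp add: vjsmooth_d_t_nth(1)[OF * s] vjsmooth_d_t_nth(1)[OF assms s] wirtv_def)
  qed
  then show "d_t (\<lambda>s. wirtv e (h s)) s p = wirtv e (d_t h s) p"
    by (simp add: vec_eq_iff)
qed

lemma jsmooth_lorentzC:
  assumes "vjsmooth T g" "vjsmooth T h"
  shows "jsmooth T (\<lambda>s p. lorentzC (g s p) (h s p))"
    and "s \<in> T \<Longrightarrow> d_t (\<lambda>s p. lorentzC (g s p) (h s p)) s p =
      lorentzC (d_t g s p) (h s p) + lorentzC (g s p) (d_t h s p)"
proof -
  have s: "smooth_on (T \<times> UNIV) (\<lambda>q. g (fst q) (snd q) $ i)"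
    "smooth_on (T \<times> UNIV) (\<lambda>q. h (fst q) (snd q) $ i)" for i
    using assms by (simp_all add: vjsmooth_def jsmooth_def case_prod_unfold)
  show "jsmooth T (\<lambda>s p. lorentzC (g s p) (h s p))"
    unfolding jsmooth_def case_prod_unfold lorentzC_def
    by (intro smooth_on_add smooth_minus smooth_sum smooth_mult s open_slab finite)
  assume sT: "s \<in> T"
  have d: "((\<lambda>r. f r p $ i) has_vector_derivative d_t f s p $ i) (at s)" if "vjsmooth T f" for f i
    using d_t_works[OF _ sT, of "\<lambda>s p. f s p $ i"] that
    by (simp add: vjsmooth_d_t_nth(1)[OF that sT] vjsmooth_def)
  note * = d[OF assms(1)] d[OF assms(2)]
  have "((\<lambda>r. lorentzC (g r p) (h r p)) has_vector_derivative
      lorentzC (d_t g s p) (h s p) + lorentzC (g s p) (d_t h s p)) (at s)"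
    unfolding lorentzC_def
    by (rule has_vector_derivative_eq_rhs,
        (rule has_vector_derivative_add has_vector_derivative_minus has_vector_derivative_sum
          has_vector_derivative_mult *)+)
      (simp add: sum.distrib)
  then show "d_t (\<lambda>s p. lorentzC (g s p) (h s p)) s p =
      lorentzC (d_t g s p) (h s p) + lorentzC (g s p) (d_t h s p)"
    unfolding d_t_def[of "\<lambda>s p. lorentzC (g s p) (h s p)"] by (rule vector_derivative_at)
qed

lemma vjsmooth_add_scale:
  assumes "vjsmooth T g" "jsmooth T f" "vjsmooth T h"
  shows "vjsmooth T (\<lambda>s p. g s p + f s p *s h s p)"
    and "s \<in> T \<Longrightarrow> d_t (\<lambda>s p. g s p + f s p *s h s p) s p =
      d_t g s p + d_t f s p *s h s p + f s p *s d_t h s p"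
proof -
  have s: "smooth_on (T \<times> UNIV) (\<lambda>q. g (fst q) (snd q) $ i)"
    "smooth_on (T \<times> UNIV) (\<lambda>q. h (fst q) (snd q) $ i)"
    "smooth_on (T \<times> UNIV) (\<lambda>q. f (fst q) (snd q))" for i
    using assms by (simp_all add: vjsmooth_def jsmooth_def case_prod_unfold)
  show "vjsmooth T (\<lambda>s p. g s p + f s p *s h s p)"
    unfolding vjsmooth_def jsmooth_def case_prod_unfold vector_add_component vector_smult_component
    by (intro allI smooth_on_add smooth_mult s open_slab)
  assume sT: "s \<in> T"
  have d: "((\<lambda>r. f r p $ i) has_vector_derivative d_t f s p $ i) (at s)" if "vjsmooth T f" for f i
    using d_t_works[OF _ sT, of "\<lambda>s p. f s p $ i"] that
    by (simp add: vjsmooth_d_t_nth(1)[OF that sT] vjsmooth_def)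
  note * = d[OF assms(1)] d[OF assms(3)] d_t_works[OF assms(2) sT]
  have "((\<lambda>r. g r p + f r p *s h r p) has_vector_derivative
      d_t g s p + d_t f s p *s h s p + f s p *s d_t h s p) (at s)"
    by (rule has_vector_derivative_vec, unfold vector_add_component vector_smult_component,
        rule has_vector_derivative_eq_rhs,
        (rule has_vector_derivative_add has_vector_derivative_mult *)+) simp
  then show "d_t (\<lambda>s p. g s p + f s p *s h s p) s p =
      d_t g s p + d_t f s p *s h s p + f s p *s d_t h s p"
    unfolding d_t_def[of "\<lambda>s p. g s p + f s p *s h s p"] by (rule vector_derivative_at)
qed

end

section \<open>Real vectors in the complexification\<close>

lemma cvec_simps [simp]:
  "cvec (v + w) = cvec v + cvec w" "cvec (v - w) = cvec v - cvec w"
  "cvec (r *\<^sub>R v) = of_real r *s cvec v" "cvec 0 = 0" "Rev (cvec v) = v" "Imv (cvec v) = 0"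
  by (simp_all add: vec_eq_iff cvec_def Rev_def Imv_def)

lemma cvec_Rev_Imv: "w = cvec (Rev w) + \<i> *s cvec (Imv w)"
  by (simp add: vec_eq_iff cvec_def Rev_def Imv_def complex_eq)

lemma cvec_Rev: "cnjv w = w \<Longrightarrow> cvec (Rev w) = w"
  by (auto simp: vec_eq_iff cvec_def Rev_def cnjv_def complex_eq_iff)

lemma cvec_inj [simp]: "cvec v = cvec w \<longleftrightarrow> v = w"
  by (auto simp: vec_eq_iff cvec_def)

lemma bounded_bilinear_lorentz: "bounded_bilinear lorentz"
proof -
  let ?R = "\<lambda>w::lvec. \<chi> i. if i = None then - w $ i else w $ i"
  have "linear ?R" by (rule linearI) (auto simp: vec_eq_iff)
  then have "bounded_bilinear (\<lambda>v w. v \<bullet> ?R w)"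
    by (intro bounded_bilinear.comp[OF bounded_bilinear_inner bounded_linear_ident])
      (simp add: linear_conv_bounded_linear)
  moreover have "lorentz v w = v \<bullet> ?R w" for v w
    by (simp add: lorentz_def inner_vec_def UNIV_option_conv sum.reindex inj_on_def)
  ultimately show ?thesis by (metis (no_types, lifting) ext)
qed

interpretation lor: bounded_bilinear lorentz by (rule bounded_bilinear_lorentz)

lemma lorentz_commute: "lorentz v w = lorentz w v"
  by (simp add: lorentz_def mult.commute)

lemmas lorentz_linear = lor.add_left lor.add_right lor.diff_left lor.diff_right
  lor.scaleR_left lor.scaleR_right lor.minus_left lor.minus_right lor.zero_left lor.zero_right

lemma wirtv_complex_combination:
  assumes "(\<xi> has_derivative \<xi>') (at p)" "(\<zeta> has_derivative \<zeta>') (at p)"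
  shows "wirtv e (\<lambda>q. cvec (\<xi> q) + \<i> *s cvec (\<zeta> q)) p =
    (1 / 2) *s (cvec (\<xi>' 1) + e *s cvec (\<xi>' \<i>)) + (\<i> / 2) *s (cvec (\<zeta>' 1) + e *s cvec (\<zeta>' \<i>))"
proof -
  have re: "((\<lambda>q. complex_of_real (\<xi> q $ i)) has_derivative (\<lambda>v. of_real (\<xi>' v $ i))) (at p)"
    if "(\<xi> has_derivative \<xi>') (at p)" for i and \<xi> \<xi>' :: "complex \<Rightarrow> lvec"
    by (intro bounded_linear.has_derivative[OF bounded_linear_of_real]
        bounded_linear.has_derivative[OF bounded_linear_vec_nth] that)
  have "dird v (\<lambda>q. complex_of_real (\<xi> q $ i) + \<i> * of_real (\<zeta> q $ i)) p =
      of_real (\<xi>' v $ i) + \<i> * of_real (\<zeta>' v $ i)" for v i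
    by (rule dird_eqI) (intro has_derivative_add has_derivative_mult_right re assms)
  then show ?thesis by (simp add: vec_eq_iff wirtv_def wirt_def cvec_def field_simps)
qed

lemma wirtv_cvec:
  assumes "(\<xi> has_derivative \<xi>') (at p)"
  shows "wirtv e (\<lambda>q. cvec (\<xi> q)) p = (1 / 2) *s (cvec (\<xi>' 1) + e *s cvec (\<xi>' \<i>))"
  using wirtv_complex_combination[OF assms has_derivative_const[of 0], of e] by simp

lemma differentiable_Rev_Imv:
  assumes "vsmooth g"
  shows "(\<lambda>p. Rev (g p)) differentiable (at p)" "(\<lambda>p. Imv (g p)) differentiable (at p)"
proof -
  have vec: "f differentiable (at p)" if f: "\<And>i. (\<lambda>q. f q $ i) differentiable (at p)" for f :: "complex \<Rightarrow> lvec"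
  proof -
    have "(\<lambda>q. f q $ i *\<^sub>R axis i (1::real)) differentiable (at p)" for i
      by (intro differentiable_scaleR f differentiable_const)
    then have "(\<lambda>q. \<Sum>i\<in>UNIV. f q $ i *\<^sub>R axis i (1::real)) differentiable (at p)"
      by (intro differentiable_sum) auto
    moreover have "(\<Sum>i\<in>UNIV. f q $ i *\<^sub>R axis i (1::real)) = f q" for q
      using basis_expansion[of "f q"] by (simp add: scalar_mult_eq_scaleR)
    ultimately show ?thesis by simp
  qed
  have d: "((\<lambda>q. g q $ i) has_derivative (\<lambda>v. dird v (\<lambda>q. g q $ i) p)) (at p)" for i
    using assms by (intro smooth_on_has_derivative[of UNIV]) (auto simp: vsmooth_def)
  show "(\<lambda>p. Rev (g p)) differentiable (at p)"
    by (rule vec) (auto simp: Rev_def differentiable_def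
        intro: bounded_linear.has_derivative[OF bounded_linear_Re d])
  show "(\<lambda>p. Imv (g p)) differentiable (at p)"
    by (rule vec) (auto simp: Imv_def differentiable_def
        intro: bounded_linear.has_derivative[OF bounded_linear_Im d])
qed

lemma complexify_linear:
  assumes "linear F"
  shows "complexify F (v + w) = complexify F v + complexify F w"
    and "complexify F (a *s w) = a *s complexify F w"
    and "complexify F (cvec u) = cvec (F u)"
proof -
  have R: "Rev (v + w) = Rev v + Rev w" "Imv (v + w) = Imv v + Imv w"
    "Rev (a *s w) = Re a *\<^sub>R Rev w - Im a *\<^sub>R Imv w" "Imv (a *s w) = Re a *\<^sub>R Imv w + Im a *\<^sub>R Rev w"
    by (simp_all add: vec_eq_iff Rev_def Imv_def)
  note l = linear_add[OF assms] linear_diff[OF assms] linear_scale[OF assms] linear_0[OF assms]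
  show "complexify F (v + w) = complexify F v + complexify F w"
    by (simp add: complexify_def R l vec_eq_iff algebra_simps)
  show "complexify F (a *s w) = a *s complexify F w"
    by (simp add: complexify_def R l vec_eq_iff complex_eq_iff cvec_def algebra_simps)
  show "complexify F (cvec u) = cvec (F u)"
    by (simp add: complexify_def l)
qed

lemma vsmooth_cvec: "smooth_on UNIV \<xi> \<Longrightarrow> vsmooth (\<lambda>p. cvec (\<xi> p))"
  unfolding vsmooth_def cvec_def
  by (simp add: smooth_on_bounded_linear[OF open_UNIV bounded_linear_of_real]
      smooth_on_bounded_linear[OF open_UNIV bounded_linear_vec_nth])

text \<open>
  Integration by parts without the integral: this is how every scalar product of derivatives of the
  lift is obtained from scalar products of lower order.
\<close>

lemma lorentzC_wirtv_swap:
  assumes "vsmooth g" "vsmooth h" "\<And>p. lorentzC (g p) (h p) = k"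
  shows "lorentzC (wirtv e g p) (h p) = - lorentzC (g p) (wirtv e h p)"
  using wirt_lorentzC[OF assms(1,2), of e p] by (simp add: assms(3) wirt_const eq_neg_iff_add_eq_0)

lemma lorentz_differentiable:
  "f differentiable (at p) \<Longrightarrow> g differentiable (at p) \<Longrightarrow> (\<lambda>x. lorentz (f x) (g x)) differentiable (at p)"
  unfolding differentiable_def using lor.FDERIV by blast

lemma eventually_nhds_pos:
  fixes f :: "'a::t2_space \<Rightarrow> real"
  assumes "isCont f p" "f p > 0"
  shows "\<forall>\<^sub>F q in nhds p. f q > 0"
  using assms by (auto simp: isCont_def tendsto_at_iff_tendsto_nhds intro: order_tendstoD(1))

section \<open>The moving frame of a normalized lift\<close>

locale conformal_lift =
  fixes \<phi> :: "complex \<Rightarrow> lvec"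
  assumes smooth_lift: "smooth_on UNIV \<phi>"
    and cone: "\<phi> p \<in> forward_cone"
    and conformal: "lorentz (frechet_derivative \<phi> (at p) v) (frechet_derivative \<phi> (at p) v) = (norm v)\<^sup>2"
begin

abbreviation "\<Phi> \<equiv> \<lambda>p. cvec (\<phi> p)"
abbreviation "\<Phi>z \<equiv> dv_z \<Phi>"
abbreviation "\<Phi>zb \<equiv> dv_zbar \<Phi>"
abbreviation "\<Theta> \<equiv> dv_zbar (dv_z \<Phi>)"

lemma vsmooth_lift [simp]: "vsmooth \<Phi>" "vsmooth \<Phi>z" "vsmooth \<Phi>zb" "vsmooth \<Theta>" "vsmooth (dv_z \<Phi>z)"
  by (simp_all add: dv_z_wirt dv_zbar_wirt vsmooth_wirtv vsmooth_cvec smooth_lift)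

lemma lift_has_derivative: "(\<phi> has_derivative (\<lambda>v. dird v \<phi> p)) (at p)"
  by (rule smooth_on_has_derivative[OF smooth_lift]) simp

lemma \<Phi>z_eq: "\<Phi>z p = (1 / 2) *s (cvec (dird 1 \<phi> p) - \<i> *s cvec (dird \<i> \<phi> p))"
  by (simp add: dv_z_wirt wirtv_cvec[OF lift_has_derivative] vec_eq_iff)

lemma \<Phi>zb_eq: "\<Phi>zb p = (1 / 2) *s (cvec (dird 1 \<phi> p) + \<i> *s cvec (dird \<i> \<phi> p))"
  by (simp add: dv_zbar_wirt wirtv_cvec[OF lift_has_derivative])

lemma cvec_dird:
  "cvec (dird 1 \<phi> p) = \<Phi>z p + \<Phi>zb p" "cvec (dird \<i> \<phi> p) = \<i> *s (\<Phi>z p - \<Phi>zb p)"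
  by (simp_all add: \<Phi>z_eq \<Phi>zb_eq vec_eq_iff field_simps)

lemma cnjv_lift [simp]: "cnjv (\<Phi>z p) = \<Phi>zb p" "cnjv (\<Phi>zb p) = \<Phi>z p" "cnjv (\<Theta> p) = \<Theta> p"
proof -
  show *: "cnjv (\<Phi>z p) = \<Phi>zb p" "cnjv (\<Phi>zb p) = \<Phi>z p" for p
    unfolding \<Phi>z_eq \<Phi>zb_eq by (simp_all add: vec_eq_iff cnjv_def cvec_def)
  have "cnjv (\<Theta> p) = wirtv (- \<i>) (\<lambda>p. cnjv (\<Phi>z p)) p"
    by (simp add: dv_zbar_wirt wirtv_cnjv del: *)
  also have "\<dots> = \<Theta> p"
    by (simp add: *, simp add: dv_z_wirt dv_zbar_wirt wirtv_commute[OF vsmooth_lift(1)])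
  finally show "cnjv (\<Theta> p) = \<Theta> p" .
qed

lemma dv_z_zbar: "dv_z \<Phi>zb = \<Theta>"
  by (rule ext) (simp add: dv_z_wirt dv_zbar_wirt wirtv_commute[OF vsmooth_lift(1)])

lemma first_fundamental_form:
  "lorentz (dird 1 \<phi> p) (dird 1 \<phi> p) = 1" "lorentz (dird \<i> \<phi> p) (dird \<i> \<phi> p) = 1"
  "lorentz (dird 1 \<phi> p) (dird \<i> \<phi> p) = 0" "lorentz (dird \<i> \<phi> p) (dird 1 \<phi> p) = 0"
proof -
  have *: "lorentz (dird v \<phi> p) (dird v \<phi> p) = (norm v)\<^sup>2" for v
    unfolding dird_def by (rule conformal)
  show 1: "lorentz (dird 1 \<phi> p) (dird 1 \<phi> p) = 1" "lorentz (dird \<i> \<phi> p) (dird \<i> \<phi> p) = 1"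
    by (simp_all add: *)
  have "dird (1 + \<i>) \<phi> p = dird 1 \<phi> p + dird \<i> \<phi> p"
    by (rule linear_simps(1)[OF has_derivative_bounded_linear[OF lift_has_derivative]])
  with *[of "1 + \<i>"] 1 have "2 * lorentz (dird 1 \<phi> p) (dird \<i> \<phi> p) = 0"
    by (simp add: lorentz_linear lorentz_commute[of "dird \<i> \<phi> p" "dird 1 \<phi> p"] cmod_def)
  then show "lorentz (dird 1 \<phi> p) (dird \<i> \<phi> p) = 0" by simp
  then show "lorentz (dird \<i> \<phi> p) (dird 1 \<phi> p) = 0" by (subst lorentz_commute)
qed

text \<open>
  Everything follows from \<open>\<langle>\<psi>, \<psi>\<rangle> = 0\<close> and \<open>|d\<psi>|\<^sup>2 = |dz|\<^sup>2\<close> by differentiation. The remaining entry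
  \<open>\<langle>\<psi>\<^sub>z\<^sub>z\<^sub>b\<^sub>a\<^sub>r, \<psi>\<^sub>z\<^sub>z\<^sub>b\<^sub>a\<^sub>r\<rangle>\<close> is not determined by these.
\<close>

lemma gram [simp]:
  "lorentzC (\<Phi> p) (\<Phi> p) = 0" "lorentzC (\<Phi>z p) (\<Phi>z p) = 0" "lorentzC (\<Phi>zb p) (\<Phi>zb p) = 0"
  "lorentzC (\<Phi>z p) (\<Phi>zb p) = 1 / 2" "lorentzC (\<Phi>zb p) (\<Phi>z p) = 1 / 2"
  "lorentzC (\<Phi> p) (\<Phi>z p) = 0" "lorentzC (\<Phi>z p) (\<Phi> p) = 0"
  "lorentzC (\<Phi> p) (\<Phi>zb p) = 0" "lorentzC (\<Phi>zb p) (\<Phi> p) = 0"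
  "lorentzC (\<Phi> p) (\<Theta> p) = - 1 / 2" "lorentzC (\<Theta> p) (\<Phi> p) = - 1 / 2"
  "lorentzC (\<Phi>z p) (\<Theta> p) = 0" "lorentzC (\<Theta> p) (\<Phi>z p) = 0"
  "lorentzC (\<Phi>zb p) (\<Theta> p) = 0" "lorentzC (\<Theta> p) (\<Phi>zb p) = 0"
proof -
  show 1: "lorentzC (\<Phi> p) (\<Phi> p) = 0" for p
    using cone[of p] by (simp add: lorentzC_cvec forward_cone_def)
  show 2: "lorentzC (\<Phi>z p) (\<Phi>z p) = 0" "lorentzC (\<Phi>zb p) (\<Phi>zb p) = 0"
    "lorentzC (\<Phi>z p) (\<Phi>zb p) = 1 / 2" for p
    by (simp_all add: \<Phi>z_eq \<Phi>zb_eq lorentzC_cvec first_fundamental_form algebra_simps)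
  have swap: "lorentzC (\<Phi> p) (wirtv e \<Phi> p) = 0" for e p
    using lorentzC_wirtv_swap[OF vsmooth_lift(1) vsmooth_lift(1) 1, of e p]
    by (simp add: lorentzC_commute[of "wirtv e \<Phi> p" "\<Phi> p"] eq_neg_iff_add_eq_0)
  show 3: "lorentzC (\<Phi> p) (\<Phi>z p) = 0" "lorentzC (\<Phi> p) (\<Phi>zb p) = 0" for p
    by (simp_all add: dv_z_wirt dv_zbar_wirt swap)
  have "lorentzC (\<Phi> p) (\<Theta> p) = - lorentzC (\<Phi>zb p) (\<Phi>z p)"
    using lorentzC_wirtv_swap[OF vsmooth_lift(1,2) 3(1), of "\<i>" p]
    by (simp add: dv_zbar_wirt[symmetric])
  then show 4: "lorentzC (\<Phi> p) (\<Theta> p) = - 1 / 2"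
    by (simp add: lorentzC_commute[of "\<Phi>zb p" "\<Phi>z p"] 2)
  have "lorentzC (wirtv \<i> \<Phi>z p) (\<Phi>z p) = 0"
    using lorentzC_wirtv_swap[OF vsmooth_lift(2,2) 2(1), of "\<i>" p]
    by (simp add: lorentzC_commute[of "\<Phi>z p" "wirtv \<i> \<Phi>z p"] eq_neg_iff_add_eq_0)
  then show 5: "lorentzC (\<Phi>z p) (\<Theta> p) = 0" by (subst lorentzC_commute) (simp add: dv_zbar_wirt)
  have "lorentzC (cnjv (\<Phi>z p)) (cnjv (\<Theta> p)) = 0"
    unfolding lorentzC_cnjv by (simp add: 5)
  then show 6: "lorentzC (\<Phi>zb p) (\<Theta> p) = 0" by simp
  show "lorentzC (\<Phi>zb p) (\<Phi>z p) = 1 / 2" "lorentzC (\<Phi>z p) (\<Phi> p) = 0" "lorentzC (\<Phi>zb p) (\<Phi> p) = 0"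
    "lorentzC (\<Theta> p) (\<Phi> p) = - 1 / 2" "lorentzC (\<Theta> p) (\<Phi>z p) = 0" "lorentzC (\<Theta> p) (\<Phi>zb p) = 0"
    using 2 3 4 5 6 lorentzC_commute by metis+
qed

definition "\<theta> p = Rev (\<Theta> p)"

lemma cvec_\<theta>: "cvec (\<theta> p) = \<Theta> p"
  by (simp add: \<theta>_def cvec_Rev)

text \<open>
  The orthogonal projection onto the normal bundle, obtained by inverting the Gram matrix of the frame:
  \<open>\<psi>\<close> is dual to \<open>\<psi>\<^sub>z\<^sub>z\<^sub>b\<^sub>a\<^sub>r\<close> and \<open>\<psi>\<^sub>z\<close> to \<open>\<psi>\<^sub>z\<^sub>b\<^sub>a\<^sub>r\<close>, with a correction by
  \<open>\<langle>\<psi>\<^sub>z\<^sub>z\<^sub>b\<^sub>a\<^sub>r, \<psi>\<^sub>z\<^sub>z\<^sub>b\<^sub>a\<^sub>r\<rangle>\<close> because \<open>\<psi>\<^sub>z\<^sub>z\<^sub>b\<^sub>a\<^sub>r\<close> need not be null. The real form uses the orthonormal pair of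
  partial derivatives instead.
\<close>

definition projC :: "complex \<Rightarrow> lvecC \<Rightarrow> lvecC" where
  "projC p w = w + (2 * lorentzC w (\<Theta> p) + 4 * lorentzC (\<Theta> p) (\<Theta> p) * lorentzC w (\<Phi> p)) *s \<Phi> p
     - (2 * lorentzC w (\<Phi>zb p)) *s \<Phi>z p - (2 * lorentzC w (\<Phi>z p)) *s \<Phi>zb p
     + (2 * lorentzC w (\<Phi> p)) *s \<Theta> p"

definition projR :: "complex \<Rightarrow> lvec \<Rightarrow> lvec" where
  "projR p w = w + (2 * lorentz w (\<theta> p) + 4 * lorentz (\<theta> p) (\<theta> p) * lorentz w (\<phi> p)) *\<^sub>R \<phi> p
     - lorentz w (dird 1 \<phi> p) *\<^sub>R dird 1 \<phi> p - lorentz w (dird \<i> \<phi> p) *\<^sub>R dird \<i> \<phi> p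
     + (2 * lorentz w (\<phi> p)) *\<^sub>R \<theta> p"

lemma projC_linear [simp]:
  "projC p (v + w) = projC p v + projC p w" "projC p (v - w) = projC p v - projC p w"
  "projC p (a *s w) = a *s projC p w"
  by (simp_all add: projC_def vec_eq_iff algebra_simps)

lemma projC_tangent [simp]:
  "projC p (\<Phi> p) = 0" "projC p (\<Phi>z p) = 0" "projC p (\<Phi>zb p) = 0" "projC p (\<Theta> p) = 0"
  by (simp_all add: projC_def vec_eq_iff)

lemma cvec_projR: "cvec (projR p w) = projC p (cvec w)"
  by (simp add: projR_def projC_def cvec_\<theta>[symmetric] lorentzC_cvec \<Phi>z_eq \<Phi>zb_eq vec_eq_iff algebra_simps)

lemma cnjv_projC: "cnjv (projC p w) = projC p (cnjv w)"
proof -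
  have "cnj (lorentzC w v) = lorentzC (cnjv w) (cnjv v)" for v w by (simp add: lorentzC_cnjv)
  then show ?thesis by (simp add: projC_def algebra_simps)
qed

lemma gramR [simp]:
  "lorentz (\<phi> p) (\<phi> p) = 0" "lorentz (\<phi> p) (dird 1 \<phi> p) = 0" "lorentz (\<phi> p) (dird \<i> \<phi> p) = 0"
  "lorentz (\<phi> p) (\<theta> p) = - 1 / 2" "lorentz (dird 1 \<phi> p) (\<theta> p) = 0" "lorentz (dird \<i> \<phi> p) (\<theta> p) = 0"
proof -
  have *: "complex_of_real (lorentz v w) = lorentzC (cvec v) (cvec w)" for v w
    by (simp add: lorentzC_cvec)
  have "complex_of_real (lorentz (\<phi> p) (\<phi> p)) = of_real 0"
    "complex_of_real (lorentz (\<phi> p) (dird 1 \<phi> p)) = of_real 0"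
    "complex_of_real (lorentz (\<phi> p) (dird \<i> \<phi> p)) = of_real 0"
    "complex_of_real (lorentz (\<phi> p) (\<theta> p)) = of_real (- 1 / 2)"
    "complex_of_real (lorentz (dird 1 \<phi> p) (\<theta> p)) = of_real 0"
    "complex_of_real (lorentz (dird \<i> \<phi> p) (\<theta> p)) = of_real 0"
    unfolding * cvec_dird cvec_\<theta> by simp_all
  then show "lorentz (\<phi> p) (\<phi> p) = 0" "lorentz (\<phi> p) (dird 1 \<phi> p) = 0" "lorentz (\<phi> p) (dird \<i> \<phi> p) = 0"
    "lorentz (\<phi> p) (\<theta> p) = - 1 / 2" "lorentz (dird 1 \<phi> p) (\<theta> p) = 0" "lorentz (dird \<i> \<phi> p) (\<theta> p) = 0"
    by (simp_all only: of_real_eq_iff)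
qed

lemma V_fibre_eq: "V_fibre \<phi> p = span {\<phi> p, dird 1 \<phi> p, dird \<i> \<phi> p, \<theta> p}"
proof -
  have bl: "bounded_linear (\<lambda>v. dird v \<phi> p)"
    by (rule has_derivative_bounded_linear[OF lift_has_derivative])
  have "dird v \<phi> p = Re v *\<^sub>R dird 1 \<phi> p + Im v *\<^sub>R dird \<i> \<phi> p" for v
  proof -
    have "v = Re v *\<^sub>R 1 + Im v *\<^sub>R \<i>" by (simp add: complex_eq_iff)
    then have "dird v \<phi> p = dird (Re v *\<^sub>R 1 + Im v *\<^sub>R \<i>) \<phi> p" by simp
    then show ?thesis by (simp only: linear_simps[OF bl])
  qed
  then have "frechet_derivative \<phi> (at p) v \<in> span {\<phi> p, dird 1 \<phi> p, dird \<i> \<phi> p, \<theta> p}" for v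
    unfolding dird_def by (metis (no_types, lifting) insertI1 insertI2 span_add span_base span_mul)
  then have 1: "{\<phi> p} \<union> range (frechet_derivative \<phi> (at p)) \<union> {\<theta> p}
      \<subseteq> span {\<phi> p, dird 1 \<phi> p, dird \<i> \<phi> p, \<theta> p}"
    by (auto intro: span_base)
  have 2: "{\<phi> p, dird 1 \<phi> p, dird \<i> \<phi> p, \<theta> p}
      \<subseteq> {\<phi> p} \<union> range (frechet_derivative \<phi> (at p)) \<union> {\<theta> p}"
    by (auto simp: dird_def)
  show ?thesis
    unfolding V_fibre_def \<theta>_def[symmetric]
    using span_mono[OF 2] span_mono[OF 1] by (simp add: span_span)
qed

lemma N_fibre_iff:
  "n \<in> N_fibre \<phi> p \<longleftrightarrow> lorentz (\<phi> p) n = 0 \<and> lorentz (dird 1 \<phi> p) n = 0 \<and>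
     lorentz (dird \<i> \<phi> p) n = 0 \<and> lorentz (\<theta> p) n = 0" (is "_ \<longleftrightarrow> ?R")
proof
  assume "n \<in> N_fibre \<phi> p"
  then show ?R by (simp add: N_fibre_def V_fibre_eq span_base)
next
  assume R: ?R
  have "lorentz v n = 0" if "v \<in> span {\<phi> p, dird 1 \<phi> p, dird \<i> \<phi> p, \<theta> p}" for v
    using that by (induction rule: span_induct_alt) (use R in \<open>auto simp: lorentz_linear\<close>)
  then show "n \<in> N_fibre \<phi> p" by (simp add: N_fibre_def V_fibre_eq)
qed

lemma projR_linear: "linear (projR p)"
  by (rule linearI) (simp_all add: projR_def lorentz_linear algebra_simps)

lemma projR_N: "projR p w \<in> N_fibre \<phi> p"
  by (simp add: N_fibre_iff projR_def lorentz_linear first_fundamental_form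
      lorentz_commute[of "\<phi> p" w] lorentz_commute[of "dird 1 \<phi> p" w] lorentz_commute[of "dird \<i> \<phi> p" w]
      lorentz_commute[of "\<theta> p" w] lorentz_commute[of "\<theta> p" "\<phi> p"]
      lorentz_commute[of "dird 1 \<phi> p" "\<phi> p"] lorentz_commute[of "dird \<i> \<phi> p" "\<phi> p"]
      lorentz_commute[of "\<theta> p" "dird 1 \<phi> p"] lorentz_commute[of "\<theta> p" "dird \<i> \<phi> p"], simp add: field_simps)

lemma projR_id: "n \<in> N_fibre \<phi> p \<Longrightarrow> projR p n = n"
  by (simp add: N_fibre_iff projR_def lorentz_commute[of n "\<phi> p"] lorentz_commute[of n "\<theta> p"]
      lorentz_commute[of n "dird 1 \<phi> p"] lorentz_commute[of n "dird \<i> \<phi> p"])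

lemma projR_V: 
  assumes "v \<in> V_fibre \<phi> p" shows "projR p v = 0"
proof -
  have "cvec (projR p (\<phi> p)) = cvec 0" "cvec (projR p (dird 1 \<phi> p)) = cvec 0"
    "cvec (projR p (dird \<i> \<phi> p)) = cvec 0" "cvec (projR p (\<theta> p)) = cvec 0"
    unfolding cvec_projR cvec_dird cvec_\<theta> by simp_all
  then have *: "projR p (\<phi> p) = 0" "projR p (dird 1 \<phi> p) = 0"
    "projR p (dird \<i> \<phi> p) = 0" "projR p (\<theta> p) = 0"
    unfolding cvec_inj by simp_all
  show ?thesis
    using assms unfolding V_fibre_eq
    by (induction rule: span_induct_alt)
      (use * in \<open>auto simp: linear_add[OF projR_linear] linear_scale[OF projR_linear] linear_0[OF projR_linear]\<close>)
qed

text \<open>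
  Uniqueness holds because the explicit projection is the identity on the normal space and
  vanishes on the tangential one, so it computes the normal part of any such splitting.
\<close>

lemma N_proj_eq: "N_proj \<phi> p = projR p"
proof
  fix w
  have "w - projR p w \<in> V_fibre \<phi> p"
  proof -
    let ?V = "span {\<phi> p, dird 1 \<phi> p, dird \<i> \<phi> p, \<theta> p}"
    have "w - projR p w = - (2 * lorentz w (\<theta> p) + 4 * lorentz (\<theta> p) (\<theta> p) * lorentz w (\<phi> p)) *\<^sub>R \<phi> p
     + lorentz w (dird 1 \<phi> p) *\<^sub>R dird 1 \<phi> p + lorentz w (dird \<i> \<phi> p) *\<^sub>R dird \<i> \<phi> p
     + (- (2 * lorentz w (\<phi> p))) *\<^sub>R \<theta> p"
      by (simp add: projR_def algebra_simps)
    also have "\<dots> \<in> ?V" by (intro span_add span_mul span_base) auto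
    finally show ?thesis by (simp add: V_fibre_eq)
  qed
  then show "N_proj \<phi> p w = projR p w"
    unfolding N_proj_def
  proof (intro the_equality conjI projR_N)
    fix n assume n: "n \<in> N_fibre \<phi> p \<and> w - n \<in> V_fibre \<phi> p"
    then have "projR p (w - n) = 0" "projR p n = n" by (auto simp: projR_V projR_id)
    then show "n = projR p w" by (simp add: linear_diff[OF projR_linear])
  qed
qed

lemma complexify_N_proj: "complexify (N_proj \<phi> p) w = projC p w"
proof -
  have "projC p w = projC p (cvec (Rev w) + \<i> *s cvec (Imv w))" using cvec_Rev_Imv[of w] by simp
  then show ?thesis by (simp add: complexify_def N_proj_eq cvec_projR)
qed

lemma D_z_eq: "D_z \<phi> \<xi> p = projC p (dv_z \<xi> p)"
  by (simp add: D_z_def complexify_N_proj)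

lemma N_fibreC_iff:
  "w \<in> N_fibreC \<phi> p \<longleftrightarrow> lorentzC w (\<Phi> p) = 0 \<and> lorentzC w (\<Phi>z p) = 0 \<and>
     lorentzC w (\<Phi>zb p) = 0 \<and> lorentzC w (\<Theta> p) = 0"
proof -
  have r: "lorentzC w (cvec v) = of_real (lorentz v (Rev w)) + \<i> * of_real (lorentz v (Imv w))" for v
    by (subst cvec_Rev_Imv[of w]) (simp add: lorentzC_cvec lorentz_commute)
  have z: "lorentzC w (cvec v) = 0 \<longleftrightarrow> lorentz v (Rev w) = 0 \<and> lorentz v (Imv w) = 0" for v
    by (simp add: r complex_eq_iff)
  have "w \<in> N_fibreC \<phi> p \<longleftrightarrow> lorentzC w (\<Phi> p) = 0 \<and> lorentzC w (cvec (dird 1 \<phi> p)) = 0 \<and>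
     lorentzC w (cvec (dird \<i> \<phi> p)) = 0 \<and> lorentzC w (\<Theta> p) = 0"
    unfolding N_fibreC_def mem_Collect_eq N_fibre_iff cvec_\<theta>[symmetric] z by blast
  also have "\<dots> \<longleftrightarrow> lorentzC w (\<Phi> p) = 0 \<and> lorentzC w (\<Phi>z p) = 0 \<and>
     lorentzC w (\<Phi>zb p) = 0 \<and> lorentzC w (\<Theta> p) = 0"
    unfolding cvec_dird by (auto simp: add_eq_0_iff)
  finally show ?thesis .
qed

lemma projC_N: "projC p w \<in> N_fibreC \<phi> p"
proof -
  have "projC p w = cvec (projR p (Rev w)) + \<i> *s cvec (projR p (Imv w))"
    using complexify_N_proj[of p w] by (simp add: complexify_def N_proj_eq)
  moreover have "Rev (cvec u + \<i> *s cvec v) = u" "Imv (cvec u + \<i> *s cvec v) = v" for u v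
    by (simp_all add: vec_eq_iff Rev_def Imv_def cvec_def)
  ultimately show ?thesis by (simp add: N_fibreC_def projR_N)
qed

lemma vsmooth_projC:
  assumes "vsmooth g" shows "vsmooth (\<lambda>p. projC p (g p))"
  unfolding projC_def
  by (intro vsmooth_add vsmooth_diff vsmooth_scale smooth_on_add smooth_mult smooth_lorentzC
      smooth_on_const assms vsmooth_lift open_UNIV)

lemma lorentz_projR: "n \<in> N_fibre \<phi> p \<Longrightarrow> lorentz n (projR p w) = lorentz n w"
  by (simp add: N_fibre_iff projR_def lorentz_linear lorentz_commute[of n "\<phi> p"]
      lorentz_commute[of n "\<theta> p"] lorentz_commute[of n "dird 1 \<phi> p"] lorentz_commute[of n "dird \<i> \<phi> p"])

lemma projC_id: "w \<in> N_fibreC \<phi> p \<Longrightarrow> projC p w = w"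
  by (simp add: N_fibreC_iff projC_def)

subsection \<open>Second normal derivatives and the Codazzi equation\<close>

text \<open>
  For a normal section \<open>\<xi>\<close> one has \<open>\<langle>\<xi>\<^sub>z, \<psi>\<rangle> = -\<langle>\<xi>, \<psi>\<^sub>z\<rangle> = 0\<close> and
  \<open>\<langle>\<xi>\<^sub>z, \<psi>\<^sub>z\<^sub>b\<^sub>a\<^sub>r\<rangle> = -\<langle>\<xi>, \<psi>\<^sub>z\<^sub>z\<^sub>b\<^sub>a\<^sub>r\<rangle> = 0\<close>, so the tangential part of \<open>\<xi>\<^sub>z\<close> involves only \<open>\<psi>\<close> and
  \<open>\<psi>\<^sub>z\<^sub>b\<^sub>a\<^sub>r\<close>. Its \<open>z\<close>-derivative is a combination of \<open>\<psi>, \<psi>\<^sub>z, \<psi>\<^sub>z\<^sub>b\<^sub>a\<^sub>r, \<psi>\<^sub>z\<^sub>z\<^sub>b\<^sub>a\<^sub>r\<close> and is killed by the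
  projection.
\<close>

lemma normal_second_derivative:
  assumes \<xi>: "vsmooth \<xi>" "\<And>p. \<xi> p \<in> N_fibreC \<phi> p"
  shows "D_z \<phi> (D_z \<phi> \<xi>) p = projC p (dv_z (dv_z \<xi>) p)"
proof -
  let ?\<alpha> = "\<lambda>p. 2 * lorentzC (dv_z \<xi> p) (\<Theta> p)" and ?\<beta> = "\<lambda>p. - 2 * lorentzC (dv_z \<xi> p) (\<Phi>z p)"
  have sm: "vsmooth (dv_z \<xi>)" by (simp add: dv_z_wirt vsmooth_wirtv \<xi>)
  have coeff: "smooth ?\<alpha>" "smooth ?\<beta>"
    by (intro smooth_mult smooth_on_const smooth_lorentzC sm open_UNIV vsmooth_lift)+
  have perp: "lorentzC (\<xi> p) (\<Phi> p) = 0" "lorentzC (\<xi> p) (\<Phi>z p) = 0" "lorentzC (\<xi> p) (\<Phi>zb p) = 0"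
    "lorentzC (\<xi> p) (\<Theta> p) = 0" for p
    using \<xi>(2)[of p] by (auto simp: N_fibreC_iff)
  have "lorentzC (dv_z \<xi> p) (\<Phi> p) = 0" "lorentzC (dv_z \<xi> p) (\<Phi>zb p) = 0" for p
    using lorentzC_wirtv_swap[OF \<xi>(1) vsmooth_lift(1) perp(1), of "- \<i>" p]
      lorentzC_wirtv_swap[OF \<xi>(1) vsmooth_lift(3) perp(3), of "- \<i>" p]
    by (simp_all add: dv_z_wirt[symmetric] dv_z_zbar perp)
  then have D: "D_z \<phi> \<xi> = (\<lambda>p. (dv_z \<xi> p + ?\<alpha> p *s \<Phi> p) + ?\<beta> p *s \<Phi>zb p)"
    by (simp add: fun_eq_iff D_z_eq projC_def vec_eq_iff)
  have "dv_z (D_z \<phi> \<xi>) p = dv_z (dv_z \<xi>) p + (d_z ?\<alpha> p *s \<Phi> p + ?\<alpha> p *s \<Phi>z p)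
      + (d_z ?\<beta> p *s \<Phi>zb p + ?\<beta> p *s \<Theta> p)"
    unfolding D using coeff sm vsmooth_lift
    by (simp only: dv_z_wirt d_z_wirt wirtv_add wirtv_scale vsmooth_add vsmooth_scale
        dv_z_zbar[unfolded dv_z_wirt])
  then show ?thesis by (simp add: D_z_eq)
qed

text \<open>
  Pairing the defining equation with \<open>\<psi>\<^sub>z\<^sub>z\<^sub>b\<^sub>a\<^sub>r\<close> isolates \<open>c\<close>; smoothness of \<open>c\<close> and \<open>\<kappa>\<close> is then inherited from
  the lift.
\<close>

lemma schwarzian_hopf_smooth:
  assumes "schwarzian_hopf \<phi> c \<kappa>"
  shows "c p = 4 * lorentzC (dv_z \<Phi>z p) (\<Theta> p)" and "smooth c" and "vsmooth \<kappa>"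
    and "\<kappa> p \<in> N_fibreC \<phi> p"
    and "\<kappa> p = dv_z \<Phi>z p + (c p / 2) *s \<Phi> p"
    and "dv_z \<Phi>z p = \<kappa> p - (c p / 2) *s \<Phi> p"
proof -
  show N: "\<kappa> p \<in> N_fibreC \<phi> p" and \<kappa>: "\<kappa> p = dv_z \<Phi>z p + (c p / 2) *s \<Phi> p" for p
    using assms by (auto simp: schwarzian_hopf_def)
  then show "dv_z \<Phi>z p = \<kappa> p - (c p / 2) *s \<Phi> p" by simp
  have "lorentzC (\<kappa> p) (\<Theta> p) = 0" for p using N[of p] by (simp add: N_fibreC_iff)
  then have "lorentzC (dv_z \<Phi>z p) (\<Theta> p) * 4 = c p" for p
    unfolding \<kappa> by simp
  then show c: "c p = 4 * lorentzC (dv_z \<Phi>z p) (\<Theta> p)" for p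
    by (metis mult.commute)
  show sc: "smooth c"
    unfolding c[abs_def] by (intro smooth_mult smooth_on_const smooth_lorentzC open_UNIV vsmooth_lift)
  have "smooth (\<lambda>p. (1 / 2) * c p)" by (intro smooth_mult smooth_on_const open_UNIV sc)
  then have "smooth (\<lambda>p. c p / 2)" by simp
  then show "vsmooth \<kappa>"
    unfolding \<kappa>[abs_def] by (intro vsmooth_add vsmooth_scale vsmooth_lift)
qed

text \<open>
  A real \<open>\<kappa>\<close> also equals its conjugate \<open>\<psi>\<^sub>z\<^sub>b\<^sub>a\<^sub>r\<^sub>z\<^sub>b\<^sub>a\<^sub>r + (cnj c/2)\<psi>\<close>. Differentiating this expression twice in
  \<open>z\<close> and projecting leaves \<open>P(\<psi>\<^sub>z\<^sub>z\<^sub>z\<^sub>b\<^sub>a\<^sub>r\<^sub>z\<^sub>b\<^sub>a\<^sub>r) + (cnj c/2)\<kappa>\<close>. Adding \<open>(c/2)\<kappa>\<close> yields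
  \<open>P(\<psi>\<^sub>z\<^sub>z\<^sub>z\<^sub>b\<^sub>a\<^sub>r\<^sub>z\<^sub>b\<^sub>a\<^sub>r) + Re(c)\<kappa>\<close>, which is real because the fourth derivative is symmetric.
\<close>

lemma real_hopf_codazzi:
  assumes sh: "schwarzian_hopf \<phi> c \<kappa>" and real: "isothermic \<kappa>"
  shows "cnjv (D_z \<phi> (D_z \<phi> \<kappa>) p + (c p / 2) *s \<kappa> p) = D_z \<phi> (D_z \<phi> \<kappa>) p + (c p / 2) *s \<kappa> p"
proof -
  note s = schwarzian_hopf_smooth[OF sh]
  let ?c = "\<lambda>p. cnj (c p) / 2"
  let ?P = "wirtv (- \<i>) (wirtv (- \<i>) (wirtv \<i> (wirtv \<i> \<Phi>))) p"
  have cnj: "\<kappa> p = cnjv (\<kappa> p)" for p using real by (simp add: isothermic_def)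
  have "smooth (\<lambda>p. (1 / 2) * cnj (c p))" by (intro smooth_mult smooth_on_const smooth_cnj open_UNIV s)
  then have sc: "smooth ?c" by simp
  have "\<kappa> p = wirtv \<i> (wirtv \<i> \<Phi>) p + ?c p *s \<Phi> p" for p
  proof -
    have "\<kappa> p = cnjv (dv_z \<Phi>z p) + ?c p *s \<Phi> p"
      by (subst cnj) (simp add: s(5))
    also have "cnjv (dv_z \<Phi>z p) = wirtv \<i> (wirtv \<i> \<Phi>) p"
      using wirtv_cnjv[OF vsmooth_lift(2), of "\<i>" p] by (simp add: dv_z_wirt[symmetric] dv_zbar_wirt[symmetric])
    finally show ?thesis .
  qed
  then have \<kappa>: "\<kappa> = (\<lambda>p. wirtv \<i> (wirtv \<i> \<Phi>) p + ?c p *s \<Phi> p)" by (rule ext)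
  have "wirtv (- \<i>) \<kappa> = (\<lambda>p. wirtv (- \<i>) (wirtv \<i> (wirtv \<i> \<Phi>)) p
      + (wirt (- \<i>) ?c p *s \<Phi> p + ?c p *s wirtv (- \<i>) \<Phi> p))"
    unfolding \<kappa> by (rule ext)
      (simp only: wirtv_add wirtv_scale vsmooth_scale vsmooth_wirtv vsmooth_lift sc)
  then have "dv_z (dv_z \<kappa>) p = ?P + (wirt (- \<i>) (wirt (- \<i>) ?c) p *s \<Phi> p + wirt (- \<i>) ?c p *s \<Phi>z p
      + (wirt (- \<i>) ?c p *s \<Phi>z p + ?c p *s dv_z \<Phi>z p))"
    unfolding dv_z_wirt
    by (simp only: wirtv_add wirtv_scale vsmooth_scale vsmooth_add vsmooth_wirtv smooth_wirt
        vsmooth_lift sc)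
  then have "D_z \<phi> (D_z \<phi> \<kappa>) p = projC p ?P + ?c p *s \<kappa> p"
    by (simp only: normal_second_derivative[OF s(3,4)] projC_linear projC_tangent)
      (simp add: s(6) projC_id[OF s(4)])
  then have *: "D_z \<phi> (D_z \<phi> \<kappa>) p + (c p / 2) *s \<kappa> p = projC p ?P + (?c p + c p / 2) *s \<kappa> p"
    by (simp add: vec_eq_iff algebra_simps)
  have cw: "cnjv (wirtv (- \<i>) g q) = wirtv \<i> (\<lambda>p. cnjv (g p)) q" if "vsmooth g" for g q
    using wirtv_cnjv[OF that, of "\<i>" q] by simp
  have cw': "cnjv (wirtv \<i> g q) = wirtv (- \<i>) (\<lambda>p. cnjv (g p)) q" if "vsmooth g" for g q
    using wirtv_cnjv[OF that, of "- \<i>" q] by simp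
  have "cnjv ?P = wirtv \<i> (wirtv \<i> (wirtv (- \<i>) (wirtv (- \<i>) \<Phi>))) p"
    by (simp add: cw cw' vsmooth_wirtv)
  also have "\<dots> = ?P"
  proof -
    have com: "wirtv \<i> (wirtv (- \<i>) g) = wirtv (- \<i>) (wirtv \<i> g)" if "vsmooth g" for g
      by (rule ext) (rule wirtv_commute[OF that])
    show ?thesis by (simp add: com vsmooth_wirtv)
  qed
  finally show ?thesis
    unfolding * using cnj[of p] by (simp add: cnjv_projC add.commute)
qed

subsection \<open>The normal plane\<close>

lemma N_fibre_subspace: "subspace (N_fibre \<phi> p)"
  by (auto simp: subspace_def N_fibre_def lorentz_linear)

text \<open>
  Subtracting the multiple of the null vector \<open>\<psi>\<close> that removes the time component does not change
  \<open>\<langle>n, n\<rangle>\<close> and leaves a sum of squares. If that sum vanishes, \<open>n\<close> is a multiple of \<open>\<psi>\<close>, and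
  orthogonality to \<open>\<psi>\<^sub>z\<^sub>z\<^sub>b\<^sub>a\<^sub>r\<close> makes the multiple zero.
\<close>

lemma N_fibre_positive:
  assumes "n \<in> N_fibre \<phi> p" "n \<noteq> 0"
  shows "lorentz n n > 0"
proof -
  define r where "r = n $ None / \<phi> p $ None"
  define m where "m = n - r *\<^sub>R \<phi> p"
  have pos: "\<phi> p $ None > 0" using cone[of p] by (simp add: forward_cone_def)
  have n: "lorentz (\<phi> p) n = 0" "lorentz (\<theta> p) n = 0" using assms by (auto simp: N_fibre_iff)
  have m0: "m $ None = 0" using pos by (simp add: m_def r_def)
  have nm: "n = m + r *\<^sub>R \<phi> p" by (simp add: m_def)
  have "lorentz n n = lorentz m m"
    using n by (simp add: m_def lorentz_linear lorentz_commute[of n "\<phi> p"])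
  also have "\<dots> = (\<Sum>k\<in>UNIV. (m $ Some k)\<^sup>2)" by (simp add: lorentz_def m0 power2_eq_square)
  finally have eq: "lorentz n n = (\<Sum>k\<in>UNIV. (m $ Some k)\<^sup>2)" .
  show ?thesis
  proof (rule ccontr)
    assume "\<not> lorentz n n > 0"
    then have "(\<Sum>k\<in>UNIV. (m $ Some k)\<^sup>2) = 0" unfolding eq
      by (meson linorder_not_less order_antisym sum_nonneg zero_le_power2)
    then have "\<forall>k. m $ Some k = 0" by (simp add: sum_nonneg_eq_0_iff)
    with m0 have "m = 0" by (metis (full_types) option.exhaust vec_eq_iff zero_index)
    then have "n = r *\<^sub>R \<phi> p" by (simp add: nm)
    moreover from this n(2) have "r = 0" by (simp add: lorentz_linear lorentz_commute[of "\<theta> p" "\<phi> p"])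
    ultimately show False using assms(2) by simp
  qed
qed

lemma lorentz_nondegenerate: "(\<And>v. lorentz v x = 0) \<Longrightarrow> x = 0"
proof -
  assume z: "\<And>v. lorentz v x = 0"
  have "x $ i = 0" for i
  proof (cases i)
    case None
    then show ?thesis using z[of "axis None 1"] by (simp add: lorentz_def axis_def)
  next
    case (Some k)
    have "lorentz (axis (Some k) 1) x = x $ Some k"
      by (simp add: lorentz_def axis_def if_distrib[where f="\<lambda>u. u * _"] cong: if_cong)
    then show ?thesis using z Some by simp
  qed
  then show "x = 0" by (simp add: vec_eq_iff)
qed

text \<open>
  The normal space is cut out of a six-dimensional space by four linear conditions.
\<close>

lemma N_fibre_nonzero: obtains n where "n \<in> N_fibre \<phi> p" "n \<noteq> 0"
proof -
  let ?S = "{\<phi> p, dird 1 \<phi> p, dird \<i> \<phi> p, \<theta> p}"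
  let ?R = "\<lambda>w::lvec. \<chi> i. if i = None then - w $ i else w $ i"
  have "dim ?S \<le> card ?S" by (rule dim_le_card[OF span_superset]) auto
  also have "\<dots> \<le> 4" by (simp add: card_insert_if)
  finally have "dim ?S < DIM(lvec)" by simp
  then obtain x where x: "x \<noteq> 0" "\<And>y. y \<in> span ?S \<Longrightarrow> orthogonal x y"
    using orthogonal_to_subspace_exists by metis
  have R: "lorentz y (?R x) = x \<bullet> y" for y
    by (simp add: lorentz_def inner_vec_def UNIV_option_conv sum.reindex inj_on_def mult.commute)
  have "?R x \<in> N_fibre \<phi> p"
  proof -
    have "x \<bullet> y = 0" if "y \<in> ?S" for y
      using x(2)[OF span_base[OF that]] by (simp add: orthogonal_def)
    then show ?thesis unfolding N_fibre_iff R by simp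
  qed
  moreover have "?R x \<noteq> 0"
  proof
    assume "?R x = 0"
    then have "x \<bullet> x = 0" using R[of x] by (simp add: lorentz_linear)
    then show False using x by simp
  qed
  ultimately show thesis by (rule that)
qed

text \<open>
  Together with the frame of \<open>V\<close>, two nonzero orthogonal normal vectors form a basis of the six-dimensional
  space, and the Lorentz form is nondegenerate.
\<close>

lemma N_fibre_two_dim:
  assumes N: "n \<in> N_fibre \<phi> p" "m \<in> N_fibre \<phi> p" "n \<noteq> 0" "m \<noteq> 0" "lorentz n m = 0"
    and x: "x \<in> N_fibre \<phi> p" "lorentz n x = 0" "lorentz m x = 0"
  shows "x = 0"
proof -
  \<comment> \<open>Domain and codomain both have dimension six, so injectivity gives surjectivity.\<close>
  define F where "F = (\<lambda>(a :: real, b :: real, c :: real, d :: real, e :: real, g :: real).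
     a *\<^sub>R \<phi> p + b *\<^sub>R dird 1 \<phi> p + c *\<^sub>R dird \<i> \<phi> p + d *\<^sub>R \<theta> p + e *\<^sub>R n + g *\<^sub>R m)"
  have lin: "linear F"
    unfolding F_def by (rule linearI) (auto simp: algebra_simps)
  have perp: "lorentz (\<phi> p) k = 0" "lorentz (dird 1 \<phi> p) k = 0"
     "lorentz (dird \<i> \<phi> p) k = 0" "lorentz (\<theta> p) k = 0"
     "lorentz k (\<phi> p) = 0" "lorentz k (dird 1 \<phi> p) = 0"
     "lorentz k (dird \<i> \<phi> p) = 0" "lorentz k (\<theta> p) = 0" if "k \<in> N_fibre \<phi> p" for k
    using that lorentz_commute[of k] by (auto simp: N_fibre_iff)
  have g2: "lorentz (dird 1 \<phi> p) (\<phi> p) = 0" "lorentz (dird \<i> \<phi> p) (\<phi> p) = 0" "lorentz (\<theta> p) (\<phi> p) = - 1 / 2"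
    "lorentz (\<theta> p) (dird 1 \<phi> p) = 0" "lorentz (\<theta> p) (dird \<i> \<phi> p) = 0" "lorentz m n = 0"
    using gramR[of p] N(5) lorentz_commute by metis+
  have "inj F"
    unfolding linear_injective_0[OF lin]
  proof (intro allI impI)
    fix q assume q: "F q = 0"
    obtain a b c d e g where q_def: "q = (a, b, c, d, e, g)" by (metis surj_pair)
    let ?w = "a *\<^sub>R \<phi> p + b *\<^sub>R dird 1 \<phi> p + c *\<^sub>R dird \<i> \<phi> p + d *\<^sub>R \<theta> p + e *\<^sub>R n + g *\<^sub>R m"
    have w: "lorentz ?w y = 0" for y using q by (simp add: F_def q_def lorentz_linear)
    note sim = lorentz_linear perp[OF N(1)] perp[OF N(2)] g2 N(5) first_fundamental_form
    have "d = 0" using w[of "\<phi> p"] by (simp add: sim)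
    moreover have "b = 0" using w[of "dird 1 \<phi> p"] by (simp add: sim)
    moreover have "c = 0" using w[of "dird \<i> \<phi> p"] by (simp add: sim)
    moreover have "e = 0" using w[of n] N_fibre_positive[OF N(1,3)] by (simp add: sim)
    moreover have "g = 0" using w[of m] N_fibre_positive[OF N(2,4)] by (simp add: sim)
    ultimately have "a = 0" using w[of "\<theta> p"] by (simp add: sim)
    then show "q = 0" using \<open>b = 0\<close> \<open>c = 0\<close> \<open>d = 0\<close> \<open>e = 0\<close> \<open>g = 0\<close> by (simp add: q_def zero_prod_def)
  qed
  then have "dim (range F) = DIM(real \<times> real \<times> real \<times> real \<times> real \<times> real)"
    using dim_image_eq[OF lin, of UNIV] by simp
  then have "dim (range F) = DIM(lvec)" by simp
  then have "range F = UNIV"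
    using dim_eq_full[of "range F"] linear_subspace_image[OF lin subspace_UNIV] by (metis span_eq_iff)
  then have "\<exists>q. v = F q" for v by (metis UNIV_I imageE)
  then have "lorentz v x = 0" for v
  proof -
    obtain q where "v = F q" using \<open>\<exists>q. v = F q\<close> by blast
    then show ?thesis using perp[OF x(1)] x by (cases q) (auto simp: F_def lorentz_linear)
  qed
  then show "x = 0" by (rule lorentz_nondegenerate)
qed

lemma projR_differentiable: "(\<lambda>q. projR q w) differentiable (at p)"
proof -
  have d: "\<phi> differentiable (at p)" "dird v \<phi> differentiable (at p)" "\<theta> differentiable (at p)" for v
  proof -
    show "\<phi> differentiable (at p)" "dird v \<phi> differentiable (at p)"
      using smooth_on_has_derivative[OF smooth_lift] smooth_on_has_derivative[OF smooth_on_dird[OF smooth_lift]]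
      by (auto simp: differentiable_def)
    show "\<theta> differentiable (at p)"
      unfolding \<theta>_def[abs_def] by (rule differentiable_Rev_Imv) simp
  qed
  show ?thesis
    unfolding projR_def
    by (intro differentiable_add differentiable_diff differentiable_scaleR differentiable_mult
        differentiable_const lorentz_differentiable d)
qed

end

section \<open>The rotation of the normal plane is parallel\<close>

text \<open>
  Only continuity of the rotation is assumed; its differentiability is a consequence of orthogonality.
\<close>

locale rotated_lift = conformal_lift +
  fixes J :: "complex \<Rightarrow> lvec \<Rightarrow> lvec"
  assumes J_lin: "linear (J p)"
    and J_N: "n \<in> N_fibre \<phi> p \<Longrightarrow> J p n \<in> N_fibre \<phi> p"
    and J_norm: "n \<in> N_fibre \<phi> p \<Longrightarrow> lorentz (J p n) (J p n) = lorentz n n"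
    and J_perp: "n \<in> N_fibre \<phi> p \<Longrightarrow> lorentz n (J p n) = 0"
    and J_cont: "continuous_on UNIV (\<lambda>p. J p (N_proj \<phi> p w))"
begin

lemma N_add: "n \<in> N_fibre \<phi> p \<Longrightarrow> m \<in> N_fibre \<phi> p \<Longrightarrow> n + m \<in> N_fibre \<phi> p"
  and N_diff: "n \<in> N_fibre \<phi> p \<Longrightarrow> m \<in> N_fibre \<phi> p \<Longrightarrow> n - m \<in> N_fibre \<phi> p"
  and N_scale: "n \<in> N_fibre \<phi> p \<Longrightarrow> r *\<^sub>R n \<in> N_fibre \<phi> p"
  using N_fibre_subspace by (blast intro: subspace_add subspace_diff subspace_scale)+

lemma J_isometry:
  assumes "n \<in> N_fibre \<phi> p" "m \<in> N_fibre \<phi> p"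
  shows "lorentz (J p n) (J p m) = lorentz n m"
  using J_norm[OF N_add[OF assms]] J_norm[OF assms(1)] J_norm[OF assms(2)]
    lorentz_commute[of "J p n" "J p m"] lorentz_commute[of n m]
  by (simp add: linear_add[OF J_lin] lorentz_linear)

lemma J_skew:
  assumes "n \<in> N_fibre \<phi> p" "m \<in> N_fibre \<phi> p"
  shows "lorentz (J p n) m = - lorentz n (J p m)"
  using J_perp[OF N_add[OF assms]] J_perp[OF assms(1)] J_perp[OF assms(2)]
    lorentz_commute[of "J p n" m]
  by (simp add: linear_add[OF J_lin] lorentz_linear)

lemma N_fibre_frame:
  assumes "u \<in> N_fibre \<phi> p" "u \<noteq> 0" "x \<in> N_fibre \<phi> p" "lorentz u x = 0" "lorentz (J p u) x = 0"
  shows "x = 0"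
proof (rule N_fibre_two_dim[OF assms(1) J_N[OF assms(1)] assms(2) _ J_perp[OF assms(1)] assms(3-5)])
  show "J p u \<noteq> 0"
    using J_norm[OF assms(1)] N_fibre_positive[OF assms(1,2)] by (auto simp: lorentz_linear)
qed

lemma J_squared:
  assumes n: "n \<in> N_fibre \<phi> p" shows "J p (J p n) = - n"
proof (cases "n = 0")
  case True
  then show ?thesis by (simp add: linear_0[OF J_lin])
next
  case False
  have "J p (J p n) + n = 0"
  proof (rule N_fibre_frame[OF n False])
    show "J p (J p n) + n \<in> N_fibre \<phi> p" by (intro N_add J_N n)
    show "lorentz n (J p (J p n) + n) = 0"
      using J_skew[OF n J_N[OF n]] J_norm[OF n] by (simp add: lorentz_linear)
    show "lorentz (J p n) (J p (J p n) + n) = 0"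
      using J_perp[OF J_N[OF n]] J_perp[OF n] lorentz_commute[of "J p n" n] by (simp add: lorentz_linear)
  qed
  then show ?thesis by (simp add: eq_neg_iff_add_eq_0)
qed

lemma frame_expansion:
  assumes u: "u \<in> N_fibre \<phi> p" "u \<noteq> 0" and x: "x \<in> N_fibre \<phi> p"
  shows "lorentz u u *\<^sub>R x = lorentz u x *\<^sub>R u + lorentz (J p u) x *\<^sub>R J p u"
proof -
  have "lorentz u u *\<^sub>R x - (lorentz u x *\<^sub>R u + lorentz (J p u) x *\<^sub>R J p u) = 0"
    by (rule N_fibre_frame[OF u]) (use u x J_perp[OF u(1)] J_norm[OF u(1)] lorentz_commute[of "J p u" u] in
      \<open>auto intro!: N_add N_diff N_scale J_N simp: lorentz_linear\<close>)
  then show ?thesis by simp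
qed

text \<open>
  Let \<open>u\<close> and \<open>w\<close> be the projections of \<open>n\<close> and \<open>J n\<close> to the nearby normal planes. There
  \<open>J u\<close> is determined by \<open>u\<close> and \<open>w\<close> up to sign, with \<open>\<langle>J u, w\<rangle>\<^sup>2\<close> equal to their Gram determinant, and
  continuity fixes the sign. So near \<open>p\<close> the vector \<open>J u\<close> is an expression in \<open>u\<close> and \<open>w\<close> involving the
  square root of the Gram determinant, which is positive at \<open>p\<close>.
\<close>

lemma rotated_frame_differentiable:
  assumes n: "n \<in> N_fibre \<phi> p" "n \<noteq> 0"
  shows "(\<lambda>q. J q (projR q n)) differentiable (at p)"
proof -
  define u where "u q = projR q n" for q
  define w where "w q = projR q (J p n)" for q
  define v where "v q = J q (u q)" for q
  define G where "G q = lorentz (u q) (u q) * lorentz (w q) (w q) - (lorentz (u q) (w q))\<^sup>2" for q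
  have du: "u differentiable (at p)" and dw: "w differentiable (at p)"
    unfolding u_def[abs_def] w_def[abs_def] by (rule projR_differentiable)+
  have at_p: "u p = n" "w p = J p n" "v p = J p n"
    by (simp_all add: u_def w_def v_def projR_id n J_N)
  have pos: "lorentz n n > 0" by (rule N_fibre_positive[OF n])
  have uN: "u q \<in> N_fibre \<phi> q" and wN: "w q \<in> N_fibre \<phi> q" for q
    by (simp_all add: u_def w_def projR_N)
  have "isCont v p"
    using J_cont[of n] by (simp add: v_def[abs_def] u_def N_proj_eq continuous_on_eq_continuous_at)
  then have "isCont (\<lambda>q. lorentz (v q) (w q)) p"
    by (rule lor.isCont) (rule differentiable_imp_continuous_within[OF dw])
  moreover have "lorentz (v p) (w p) > 0" using pos by (simp add: at_p J_norm n)
  ultimately have ev1: "\<forall>\<^sub>F q in nhds p. lorentz (v q) (w q) > 0"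
    by (rule eventually_nhds_pos)
  have "isCont (\<lambda>q. lorentz (u q) (u q)) p"
    by (rule differentiable_imp_continuous_within[OF lorentz_differentiable[OF du du]])
  then have ev2: "\<forall>\<^sub>F q in nhds p. lorentz (u q) (u q) > 0"
    by (rule eventually_nhds_pos) (simp add: at_p pos)
  have ev: "\<forall>\<^sub>F q in nhds p. inverse (sqrt (G q)) *\<^sub>R
      (lorentz (u q) (u q) *\<^sub>R w q - lorentz (u q) (w q) *\<^sub>R u q) = v q"
    using ev1 ev2
  proof eventually_elim
    case (elim q)
    then have u0: "u q \<noteq> 0" by (auto simp: lorentz_linear)
    have ex: "lorentz (u q) (u q) *\<^sub>R w q = lorentz (u q) (w q) *\<^sub>R u q + lorentz (v q) (w q) *\<^sub>R v q"
      using frame_expansion[OF uN u0 wN] by (simp add: v_def)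
    from arg_cong[OF ex, of "\<lambda>x. lorentz x (w q)"]
    have "G q = (lorentz (v q) (w q))\<^sup>2"
      by (simp add: lorentz_linear G_def power2_eq_square)
    then have "sqrt (G q) = lorentz (v q) (w q)" using elim by simp
    then show ?case using elim by (simp add: ex)
  qed
  have dG: "G differentiable (at p)"
    unfolding G_def[abs_def] power2_eq_square
    by (intro differentiable_diff differentiable_mult lorentz_differentiable du dw)
  have Gp: "G p > 0"
    using pos by (simp add: G_def at_p J_norm J_perp n)
  have "(\<lambda>q. inverse (sqrt (G q))) differentiable (at p)"
  proof -
    obtain G' where "(G has_derivative G') (at p)" using dG by (auto simp: differentiable_def)
    from has_derivative_real_sqrt[OF Gp this]
    have "(\<lambda>q. sqrt (G q)) differentiable (at p)" by (auto simp: differentiable_def)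
    then show ?thesis by (rule differentiable_inverse) (use Gp in simp)
  qed
  then have "(\<lambda>q. inverse (sqrt (G q)) *\<^sub>R
      (lorentz (u q) (u q) *\<^sub>R w q - lorentz (u q) (w q) *\<^sub>R u q)) differentiable (at p)"
    by (intro differentiable_scaleR differentiable_diff lorentz_differentiable du dw)
  then obtain D where D: "((\<lambda>q. inverse (sqrt (G q)) *\<^sub>R
      (lorentz (u q) (u q) *\<^sub>R w q - lorentz (u q) (w q) *\<^sub>R u q)) has_derivative D) (at p)"
    unfolding differentiable_def by blast
  have "(v has_derivative D) (at p)"
  proof (rule has_derivative_transform_eventually[OF D])
    show "\<forall>\<^sub>F q in at p. inverse (sqrt (G q)) *\<^sub>R
        (lorentz (u q) (u q) *\<^sub>R w q - lorentz (u q) (w q) *\<^sub>R u q) = v q"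
      using ev by (auto simp: eventually_at_filter elim: eventually_mono)
  qed (use eventually_nhds_x_imp_x[OF ev] in simp_all)
  then have "v differentiable (at p)" by (auto simp: differentiable_def)
  then show ?thesis by (simp add: v_def[abs_def] u_def)
qed

text \<open>
  Expand in the frame \<open>u, v = J u\<close>: from \<open>\<xi> = f u + g v\<close> follows \<open>J \<xi> = f v - g u\<close>, so it suffices to
  compare the derivatives of \<open>u\<close> and \<open>v\<close>. These are related by differentiating \<open>\<langle>v, v\<rangle> = \<langle>u, u\<rangle>\<close> and
  \<open>\<langle>u, v\<rangle> = 0\<close>, which determine the normal part of \<open>v'\<close> in the normal plane.
\<close>

lemma J_parallel_real:
  assumes N: "\<And>q. \<xi> q \<in> N_fibre \<phi> q" and d: "(\<xi> has_derivative \<xi>') (at p)"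
  obtains \<eta>' where "((\<lambda>q. J q (\<xi> q)) has_derivative \<eta>') (at p)"
    and "\<And>h. projR p (\<eta>' h) = J p (projR p (\<xi>' h))"
proof -
  obtain n where n: "n \<in> N_fibre \<phi> p" "n \<noteq> 0" by (rule N_fibre_nonzero)
  define u where "u q = projR q n" for q
  define v where "v q = J q (u q)" for q
  have du: "u differentiable (at p)" and dv: "v differentiable (at p)"
    unfolding u_def[abs_def] v_def[abs_def]
    by (rule projR_differentiable rotated_frame_differentiable[OF n])+
  have up: "u p = n" by (simp add: u_def projR_id n)
  have uN: "u q \<in> N_fibre \<phi> q" and vN: "v q \<in> N_fibre \<phi> q" for q
    by (simp_all add: u_def v_def projR_N J_N)
  have u0: "u p \<noteq> 0" by (simp add: up n)
  obtain u' where u': "(u has_derivative u') (at p)" using du by (auto simp: differentiable_def)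
  obtain v' where v': "(v has_derivative v') (at p)" using dv by (auto simp: differentiable_def)
  have Pv: "projR p (v' h) = J p (projR p (u' h))" for h
  proof -
    let ?y = "projR p (v' h) - J p (projR p (u' h))"
    have "(\<lambda>q. lorentz (v q) (v q)) = (\<lambda>q. lorentz (u q) (u q))"
      by (simp add: v_def J_norm uN)
    then have "lorentz (v p) (v' h) + lorentz (v' h) (v p) = lorentz (u p) (u' h) + lorentz (u' h) (u p)"
      using has_derivative_unique[OF lor.FDERIV[OF v' v'], of "\<lambda>h. lorentz (u p) (u' h) + lorentz (u' h) (u p)"]
        lor.FDERIV[OF u' u'] by (simp add: fun_eq_iff)
    then have 1: "lorentz (v p) (v' h) = lorentz (u p) (u' h)"
      by (simp add: lorentz_commute[of "v' h"] lorentz_commute[of "u' h"])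
    have "(\<lambda>q. lorentz (u q) (v q)) = (\<lambda>q. 0)" by (simp add: v_def J_perp uN)
    then have 2: "lorentz (u p) (v' h) + lorentz (u' h) (v p) = 0"
      using has_derivative_unique[OF lor.FDERIV[OF u' v'], of "\<lambda>h. 0"] by (simp add: fun_eq_iff)
    have "?y = 0"
    proof (rule N_fibre_frame[OF uN u0])
      show "?y \<in> N_fibre \<phi> p" by (intro N_diff J_N projR_N)
      have "lorentz (u p) (J p (projR p (u' h))) = - lorentz (v p) (projR p (u' h))"
        using J_skew[OF uN projR_N] by (simp add: v_def)
      then show "lorentz (u p) ?y = 0"
        using 2 by (simp add: lorentz_linear lorentz_projR uN vN lorentz_commute[of "u' h" "v p"])
      have "lorentz (v p) (J p (projR p (u' h))) = lorentz (u p) (projR p (u' h))"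
        unfolding v_def by (rule J_isometry[OF uN projR_N])
      then show "lorentz (J p (u p)) ?y = 0"
        using 1 by (simp add: lorentz_linear lorentz_projR uN vN v_def[symmetric])
    qed
    then show ?thesis by simp
  qed
  define f where "f q = lorentz (u q) (\<xi> q) / lorentz (u q) (u q)" for q
  define g where "g q = lorentz (v q) (\<xi> q) / lorentz (u q) (u q)" for q
  have d\<xi>: "\<xi> differentiable (at p)" using d by (auto simp: differentiable_def)
  have pos: "lorentz (u p) (u p) > 0" by (rule N_fibre_positive[OF uN u0])
  have "f differentiable (at p)" "g differentiable (at p)"
    unfolding f_def[abs_def] g_def[abs_def] using pos
    by (auto intro!: differentiable_divide lorentz_differentiable du dv d\<xi>)
  then obtain f' g' where fg: "(f has_derivative f') (at p)" "(g has_derivative g') (at p)"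
    by (auto simp: differentiable_def)
  have "isCont (\<lambda>q. lorentz (u q) (u q)) p"
    by (rule differentiable_imp_continuous_within[OF lorentz_differentiable[OF du du]])
  then have ev: "\<forall>\<^sub>F q in nhds p. lorentz (u q) (u q) > 0"
    by (rule eventually_nhds_pos) (rule pos)
  have comb: "\<xi> q = f q *\<^sub>R u q + g q *\<^sub>R v q" if "lorentz (u q) (u q) > 0" for q
  proof -
    have "u q \<noteq> 0" using that by (auto simp: lorentz_linear)
    from frame_expansion[OF uN this N, folded v_def]
    have "(1 / lorentz (u q) (u q)) *\<^sub>R (lorentz (u q) (u q) *\<^sub>R \<xi> q) =
      (1 / lorentz (u q) (u q)) *\<^sub>R (lorentz (u q) (\<xi> q) *\<^sub>R u q + lorentz (v q) (\<xi> q) *\<^sub>R v q)" by simp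
    then show ?thesis using that by (simp add: f_def g_def scaleR_add_right)
  qed
  have Jcomb: "J q (\<xi> q) = f q *\<^sub>R v q - g q *\<^sub>R u q" if "lorentz (u q) (u q) > 0" for q
    unfolding comb[OF that] using J_squared[OF uN, of q]
    by (simp add: linear_add[OF J_lin] linear_scale[OF J_lin] v_def)
  have trans: "(k has_derivative D) (at p)"
    if "(l has_derivative D) (at p)" "\<And>q. lorentz (u q) (u q) > 0 \<Longrightarrow> k q = l q" for k l :: "complex \<Rightarrow> lvec" and D
  proof (rule has_derivative_transform_eventually[OF that(1)])
    show "\<forall>\<^sub>F q in at p. l q = k q"
      using ev that(2) by (auto simp: eventually_at_filter elim: eventually_mono)
    show "l p = k p" using that(2)[OF pos] by simp
  qed simp
  define \<eta>' where "\<eta>' h = (f p *\<^sub>R v' h + f' h *\<^sub>R v p) - (g p *\<^sub>R u' h + g' h *\<^sub>R u p)" for h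
  have "\<xi>' = (\<lambda>h. (f p *\<^sub>R u' h + f' h *\<^sub>R u p) + (g p *\<^sub>R v' h + g' h *\<^sub>R v p))"
    by (rule has_derivative_unique[OF d trans[of "\<lambda>q. f q *\<^sub>R u q + g q *\<^sub>R v q"]])
      (intro has_derivative_add has_derivative_scaleR fg u' v', erule comb)
  moreover have "((\<lambda>q. J q (\<xi> q)) has_derivative \<eta>') (at p)"
    unfolding \<eta>'_def[abs_def]
    by (rule trans[of "\<lambda>q. f q *\<^sub>R v q - g q *\<^sub>R u q"]) (intro has_derivative_diff has_derivative_scaleR fg u' v', erule Jcomb)
  moreover have "J p (v p) = - u p" by (simp add: v_def J_squared uN)
  moreover have "J p (J p (projR p (u' h))) = - projR p (u' h)" for h
    by (rule J_squared[OF projR_N])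
  ultimately show thesis
    by (intro that[of \<eta>'])
      (simp_all add: \<eta>'_def linear_add[OF projR_linear] linear_diff[OF projR_linear]
        linear_scale[OF projR_linear] linear_add[OF J_lin] linear_scale[OF J_lin] Pv
        projR_id uN vN v_def[symmetric])
qed

lemma J_parallel:
  assumes N: "\<And>q. \<eta> q \<in> N_fibreC \<phi> q" and sm: "vsmooth \<eta>"
  shows "D_z \<phi> (\<lambda>q. complexify (J q) (\<eta> q)) p = complexify (J p) (D_z \<phi> \<eta> p)"
proof -
  let ?a = "\<lambda>q. Rev (\<eta> q)" and ?b = "\<lambda>q. Imv (\<eta> q)"
  have ab: "?a q \<in> N_fibre \<phi> q" "?b q \<in> N_fibre \<phi> q" for q
    using N[of q] by (auto simp: N_fibreC_def)
  obtain a' where a': "(?a has_derivative a') (at p)"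
    using differentiable_Rev_Imv(1)[OF sm] by (auto simp: differentiable_def)
  obtain b' where b': "(?b has_derivative b') (at p)"
    using differentiable_Rev_Imv(2)[OF sm] by (auto simp: differentiable_def)
  obtain a'' where a'': "((\<lambda>q. J q (?a q)) has_derivative a'') (at p)"
    "\<And>h. projR p (a'' h) = J p (projR p (a' h))"
    using J_parallel_real[of ?a, OF ab(1) a'] by blast
  obtain b'' where b'': "((\<lambda>q. J q (?b q)) has_derivative b'') (at p)"
    "\<And>h. projR p (b'' h) = J p (projR p (b' h))"
    using J_parallel_real[of ?b, OF ab(2) b'] by blast
  have "\<eta> = (\<lambda>q. cvec (?a q) + \<i> *s cvec (?b q))" using cvec_Rev_Imv by blast
  then have "dv_z \<eta> p = dv_z (\<lambda>q. cvec (?a q) + \<i> *s cvec (?b q)) p" by simp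
  then have 1: "D_z \<phi> \<eta> p = (1 / 2) *s (cvec (projR p (a' 1)) + (- \<i>) *s cvec (projR p (a' \<i>))) +
      (\<i> / 2) *s (cvec (projR p (b' 1)) + (- \<i>) *s cvec (projR p (b' \<i>)))"
    unfolding D_z_eq dv_z_wirt wirtv_complex_combination[OF a' b'] by (simp only: projC_linear cvec_projR)
  have "D_z \<phi> (\<lambda>q. complexify (J q) (\<eta> q)) p =
      (1 / 2) *s (cvec (projR p (a'' 1)) + (- \<i>) *s cvec (projR p (a'' \<i>))) +
      (\<i> / 2) *s (cvec (projR p (b'' 1)) + (- \<i>) *s cvec (projR p (b'' \<i>)))"
    unfolding D_z_eq complexify_def dv_z_wirt wirtv_complex_combination[OF a''(1) b''(1)]
    by (simp only: projC_linear cvec_projR)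
  then show ?thesis
    unfolding 1 a''(2) b''(2) by (simp only: complexify_linear[OF J_lin])
qed

text \<open>
  The first normal derivative of a normal section is again a normal section, so parallelity applies
  twice.
\<close>

lemma J_second_derivative:
  assumes N: "\<And>q. \<eta> q \<in> N_fibreC \<phi> q" and sm: "vsmooth \<eta>"
  shows "D_z \<phi> (D_z \<phi> (\<lambda>q. complexify (J q) (\<eta> q))) p = complexify (J p) (D_z \<phi> (D_z \<phi> \<eta>) p)"
proof -
  have "D_z \<phi> (\<lambda>q. complexify (J q) (\<eta> q)) = (\<lambda>q. complexify (J q) (D_z \<phi> \<eta> q))"
    using J_parallel[OF N sm] by blast
  moreover have "vsmooth (D_z \<phi> \<eta>)"
    unfolding D_z_eq[abs_def] dv_z_wirt by (intro vsmooth_projC vsmooth_wirtv sm)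
  moreover have "D_z \<phi> \<eta> q \<in> N_fibreC \<phi> q" for q by (simp add: D_z_eq projC_N)
  ultimately show ?thesis using J_parallel[of "D_z \<phi> \<eta>" p] by simp
qed

end

section \<open>Holomorphic functions on the torus\<close>

definition lattice_coord1 :: "complex \<Rightarrow> complex \<Rightarrow> complex \<Rightarrow> real" where
  "lattice_coord1 \<omega>1 \<omega>2 p = Re (p / \<omega>1) - Im (p / \<omega>1) / Im (\<omega>2 / \<omega>1) * Re (\<omega>2 / \<omega>1)"

definition lattice_coord2 :: "complex \<Rightarrow> complex \<Rightarrow> complex \<Rightarrow> real" where
  "lattice_coord2 \<omega>1 \<omega>2 p = Im (p / \<omega>1) / Im (\<omega>2 / \<omega>1)"

lemma lattice_coords:
  assumes "lattice_basis \<omega>1 \<omega>2"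
  shows "p = of_real r * \<omega>1 + of_real s * \<omega>2 \<longleftrightarrow>
    r = lattice_coord1 \<omega>1 \<omega>2 p \<and> s = lattice_coord2 \<omega>1 \<omega>2 p"
proof -
  define \<tau> where "\<tau> = \<omega>2 / \<omega>1"
  have w: "\<omega>1 \<noteq> 0" "Im \<tau> \<noteq> 0" using assms by (auto simp: lattice_basis_def \<tau>_def)
  have "p = of_real r * \<omega>1 + of_real s * \<omega>2 \<longleftrightarrow> p / \<omega>1 = of_real r + of_real s * \<tau>"
    using w by (auto simp: \<tau>_def field_simps)
  also have "\<dots> \<longleftrightarrow> Re (p / \<omega>1) = r + s * Re \<tau> \<and> Im (p / \<omega>1) = s * Im \<tau>"
    by (simp add: complex_eq_iff)
  also have "Im (p / \<omega>1) = s * Im \<tau> \<longleftrightarrow> s = Im (p / \<omega>1) / Im \<tau>"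
    using w by (auto simp: eq_divide_eq)
  also have "Re (p / \<omega>1) = r + s * Re \<tau> \<and> s = Im (p / \<omega>1) / Im \<tau> \<longleftrightarrow>
      r = Re (p / \<omega>1) - Im (p / \<omega>1) / Im \<tau> * Re \<tau> \<and> s = Im (p / \<omega>1) / Im \<tau>"
    by auto
  finally show ?thesis by (simp add: lattice_coord1_def lattice_coord2_def \<tau>_def)
qed

lemma periodic_translate:
  assumes "periodic \<omega>1 \<omega>2 g"
  shows "g (p + of_int m * \<omega>1 + of_int n * \<omega>2) = g p"
proof -
  have 1: "g (p + of_nat k * \<omega>1) = g p" "g (p + of_nat k * \<omega>2) = g p" for p k
    using assms by (induction k arbitrary: p) (auto simp: periodic_def algebra_simps, (metis add.assoc add.commute)+)
  have 2: "g (p + of_int m * \<omega>1) = g p" for p m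
    using 1(1)[of p "nat m"] 1(1)[of "p + of_int m * \<omega>1" "nat (- m)"]
    by (cases "m \<ge> 0") (auto simp: of_nat_nat)
  have 3: "g (p + of_int m * \<omega>2) = g p" for p m
    using 1(2)[of p "nat m"] 1(2)[of "p + of_int m * \<omega>2" "nat (- m)"]
    by (cases "m \<ge> 0") (auto simp: of_nat_nat)
  show ?thesis by (simp add: 2 3)
qed

lemma periodic_bounded:
  fixes g :: "complex \<Rightarrow> complex"
  assumes "lattice_basis \<omega>1 \<omega>2" "periodic \<omega>1 \<omega>2 g" "continuous_on UNIV g"
  shows "bounded (range g)"
proof -
  define h where "h = (\<lambda>(r, s). g (of_real r * \<omega>1 + of_real s * \<omega>2))"
  have "g p \<in> h ` ({0..1} \<times> {0..1})" for p
  proof -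
    define r s where "r = lattice_coord1 \<omega>1 \<omega>2 p" and "s = lattice_coord2 \<omega>1 \<omega>2 p"
    have p: "p = of_real r * \<omega>1 + of_real s * \<omega>2"
      using lattice_coords[OF assms(1)] by (simp add: r_def s_def)
    have "h (frac r, frac s) = g (p + of_int (- \<lfloor>r\<rfloor>) * \<omega>1 + of_int (- \<lfloor>s\<rfloor>) * \<omega>2)"
      by (simp add: h_def frac_def p algebra_simps)
    also have "\<dots> = g p" by (rule periodic_translate[OF assms(2)])
    finally have "g p = h (frac r, frac s)" by simp
    then show ?thesis
      using frac_lt_1[of r] frac_lt_1[of s] by (intro image_eqI[of _ _ "(frac r, frac s)"]) auto
  qed
  moreover have "compact (h ` ({0..1} \<times> {0..1}))"
    unfolding h_def case_prod_unfold
    by (intro compact_continuous_image compact_Times compact_Icc continuous_on_compose2[OF assms(3)] continuous_intros) auto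
  ultimately show ?thesis
    using bounded_subset[OF compact_imp_bounded] by (metis image_subsetI)
qed

lemma period_cell_measure:
  assumes L: "lattice_basis \<omega>1 \<omega>2"
  shows "period_cell \<omega>1 \<omega>2 \<in> sets lborel" "emeasure lborel (period_cell \<omega>1 \<omega>2) \<noteq> \<infinity>"
    "measure lborel (period_cell \<omega>1 \<omega>2) > 0"
proof -
  let ?r = "lattice_coord1 \<omega>1 \<omega>2" and ?s = "lattice_coord2 \<omega>1 \<omega>2"
  have cont: "continuous_on UNIV ?r" "continuous_on UNIV ?s"
    using L unfolding lattice_coord1_def lattice_coord2_def lattice_basis_def
    by (auto intro!: continuous_intros)
  have cell: "period_cell \<omega>1 \<omega>2 = {p. 0 \<le> ?r p \<and> ?r p < 1 \<and> 0 \<le> ?s p \<and> ?s p < 1}"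
    unfolding period_cell_def using lattice_coords[OF L] by auto
  have meas: "?r \<in> borel_measurable borel" "?s \<in> borel_measurable borel"
    using cont by (auto intro: borel_measurable_continuous_onI)
  show sets: "period_cell \<omega>1 \<omega>2 \<in> sets lborel"
    unfolding cell using meas by simp
  have "period_cell \<omega>1 \<omega>2 \<subseteq> (\<lambda>(r, s). of_real r * \<omega>1 + of_real s * \<omega>2) ` ({0..1} \<times> {0..1})"
    unfolding period_cell_def by force
  moreover have "compact ((\<lambda>(r, s). of_real r * \<omega>1 + of_real s * \<omega>2) ` ({0..1::real} \<times> {0..1::real}))"
    unfolding case_prod_unfold by (intro compact_continuous_image compact_Times compact_Icc continuous_intros)
  ultimately have bdd: "bounded (period_cell \<omega>1 \<omega>2)"
    using bounded_subset compact_imp_bounded by blast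
  show fin: "emeasure lborel (period_cell \<omega>1 \<omega>2) \<noteq> \<infinity>"
    using emeasure_bounded_finite[OF bdd] by simp
  define U where "U = {p. 0 < ?r p \<and> ?r p < 1 \<and> 0 < ?s p \<and> ?s p < 1}"
  have "open U" unfolding U_def using cont
    by (intro open_Collect_conj open_Collect_less) (auto intro: continuous_intros)
  moreover have "of_real (1 / 2) * \<omega>1 + of_real (1 / 2) * \<omega>2 \<in> U"
    using lattice_coords[OF L, of "of_real (1 / 2) * \<omega>1 + of_real (1 / 2) * \<omega>2" "1 / 2" "1 / 2"]
    by (auto simp: U_def)
  ultimately obtain e where e: "e > 0" "ball (of_real (1 / 2) * \<omega>1 + of_real (1 / 2) * \<omega>2) e \<subseteq> U"
    using openE by blast
  then have sub: "ball (of_real (1 / 2) * \<omega>1 + of_real (1 / 2) * \<omega>2) e \<subseteq> period_cell \<omega>1 \<omega>2"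
    by (auto simp: U_def cell)
  have "0 < measure lborel (ball (complex_of_real (1 / 2) * \<omega>1 + of_real (1 / 2) * \<omega>2) e)"
    by (rule content_ball_pos[OF e(1)])
  also have "\<dots> \<le> measure lborel (period_cell \<omega>1 \<omega>2)"
    by (rule measure_mono_fmeasurable[OF sub]) (use sets fin in \<open>auto simp: fmeasurable_def top.not_eq_extremum\<close>)
  finally show "measure lborel (period_cell \<omega>1 \<omega>2) > 0" .
qed

text \<open>
  A periodic entire function is bounded, hence constant; its integral is the constant times the area
  of the cell, which is positive.
\<close>

lemma holomorphic_torus_zero_mean:
  assumes L: "lattice_basis \<omega>1 \<omega>2" and per: "periodic \<omega>1 \<omega>2 b" and sm: "smooth b"
    and hol: "\<And>p. d_zbar b p = 0" and mean: "torus_integral \<omega>1 \<omega>2 b = 0"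
  shows "b p = 0"
proof -
  have "(b has_field_derivative dird 1 b q) (at q)" for q
  proof -
    have D: "(b has_derivative (\<lambda>v. dird v b q)) (at q)" by (rule smooth_on_has_derivative[OF sm]) simp
    have di: "dird \<i> b q = \<i> * dird 1 b q"
    proof -
      have "dird 1 b q + \<i> * dird \<i> b q = 0" using hol[of q] by (simp add: d_zbar_wirt wirt_def)
      then have "\<i> * (dird 1 b q + \<i> * dird \<i> b q) = 0" by simp
      then show ?thesis by (simp add: algebra_simps)
    qed
    have "dird v b q = dird 1 b q * v" for v
    proof -
      have "v = Re v *\<^sub>R 1 + Im v *\<^sub>R \<i>" by (simp add: complex_eq_iff)
      then have "dird v b q = dird (Re v *\<^sub>R 1 + Im v *\<^sub>R \<i>) b q" by simp
      also have "\<dots> = of_real (Re v) * dird 1 b q + of_real (Im v) * dird \<i> b q"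
        by (simp only: linear_simps[OF has_derivative_bounded_linear[OF D]]) (simp add: scaleR_conv_of_real)
      also have "\<dots> = dird 1 b q * (of_real (Re v) + \<i> * of_real (Im v))"
        by (simp add: di algebra_simps)
      finally show ?thesis using complex_eq[of v] by simp
    qed
    then have "(\<lambda>v. dird v b q) = (*) (dird 1 b q)" by (rule ext)
    with D show ?thesis by (simp add: has_field_derivative_def)
  qed
  then have "b holomorphic_on UNIV" by (auto simp: holomorphic_on_open)
  then have "b constant_on UNIV"
    by (rule Liouville_theorem) (intro periodic_bounded[OF L per] smooth_on_continuous sm)
  then obtain k where k: "\<And>q. b q = k" by (auto simp: constant_on_def)
  then have "b = (\<lambda>_. k)" by (rule ext)
  then have "measure lborel (period_cell \<omega>1 \<omega>2) *\<^sub>R k = 0"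
    using mean set_integral_const[OF period_cell_measure(1,2)[OF L], of k] by (simp add: torus_integral_def)
  then show ?thesis using period_cell_measure(3)[OF L] k by simp
qed

section \<open>Smoothness of a family of normalized lifts\<close>

lemma null_rep_linear_part:
  defines "L \<equiv> \<lambda>x::real^5. \<chi> i. case i of None \<Rightarrow> 0 | Some k \<Rightarrow> x $ k"
  shows "bounded_linear L" "null_rep x = axis None 1 + L x"
    "lorentz (null_rep x) (null_rep x) = x \<bullet> x - 1" "lorentz (null_rep x) (L y) = x \<bullet> y"
    "lorentz (L x) (L y) = x \<bullet> y"
proof -
  have "linear L" unfolding L_def by (rule linearI) (auto simp: vec_eq_iff split: option.split)
  then show "bounded_linear L" by (simp add: linear_conv_bounded_linear)
  show "null_rep x = axis None 1 + L x"
    by (auto simp: vec_eq_iff L_def null_rep_def axis_def split: option.split)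
  show "lorentz (null_rep x) (null_rep x) = x \<bullet> x - 1" "lorentz (null_rep x) (L y) = x \<bullet> y"
    "lorentz (L x) (L y) = x \<bullet> y"
    by (simp_all add: lorentz_def null_rep_def L_def inner_vec_def)
qed

text \<open>
  The vector \<open>(1, g)\<close> is null and orthogonal to its derivatives, so the lift \<open>\<phi> = \<mu> (1, g)\<close> has
  \<open>|\<phi>\<^sub>x|\<^sup>2 = \<mu>\<^sup>2 |g\<^sub>x|\<^sup>2\<close>: the derivative of \<open>\<mu>\<close> drops out and the normalization determines \<open>\<mu>\<close>.
\<close>

lemma normalized_lift_formula:
  assumes imm: "conformal_immersion \<omega>1 \<omega>2 g" and lift: "normalized_lift \<omega>1 \<omega>2 g \<phi>"
  shows "dird 1 g p \<bullet> dird 1 g p > 0"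
    and "\<phi> p = (dird 1 g p \<bullet> dird 1 g p) powr (- 1 / 2) *\<^sub>R null_rep (g p)"
proof -
  let ?L = "\<lambda>x::real^5. (\<chi> i. case i of None \<Rightarrow> 0 | Some k \<Rightarrow> x $ k) :: lvec"
  note L = null_rep_linear_part
  define \<mu> where "\<mu> q = \<phi> q $ None" for q
  have sg: "smooth_on UNIV g" and unit: "norm (g q) = 1" for q
    using imm by (auto simp: conformal_immersion_def)
  have s\<phi>: "smooth_on UNIV \<phi>" and conf: "lorentz (dird v \<phi> q) (dird v \<phi> q) = (norm v)\<^sup>2"
    and cone: "\<phi> q \<in> forward_cone" and sp: "span {\<phi> q} = span {null_rep (g q)}" for v q
    using lift by (auto simp: normalized_lift_def dird_def)
  obtain r where "r > 0" "\<forall>v. norm (frechet_derivative g (at p) v) = r * norm v"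
    using imm unfolding conformal_immersion_def by blast
  then have "norm (dird 1 g p) > 0" by (simp add: dird_def)
  then show pos: "dird 1 g p \<bullet> dird 1 g p > 0" by simp
  have \<phi>: "\<phi> q = \<mu> q *\<^sub>R null_rep (g q)" for q
  proof -
    have "\<phi> q \<in> span {null_rep (g q)}" using sp[of q] by (metis singletonI span_base)
    then obtain k where k: "\<phi> q = k *\<^sub>R null_rep (g q)" by (auto simp: span_singleton)
    then have "\<mu> q = k" by (simp add: \<mu>_def null_rep_def)
    then show ?thesis using k by simp
  qed
  have dg: "(g has_derivative (\<lambda>v. dird v g p)) (at p)"
    by (rule smooth_on_has_derivative[OF sg]) simp
  have "(\<mu> has_derivative (\<lambda>v. dird v \<phi> p $ None)) (at p)"
    unfolding \<mu>_def
    by (rule bounded_linear.has_derivative[OF bounded_linear_vec_nth smooth_on_has_derivative[OF s\<phi>]]) simp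
  moreover have "((\<lambda>q. null_rep (g q)) has_derivative (\<lambda>v. ?L (dird v g p))) (at p)"
    unfolding L(2) by (rule has_derivative_eq_rhs[OF has_derivative_add[OF has_derivative_const
          bounded_linear.has_derivative[OF L(1) dg]]]) simp
  ultimately have "((\<lambda>q. \<mu> q *\<^sub>R null_rep (g q)) has_derivative
      (\<lambda>v. \<mu> p *\<^sub>R ?L (dird v g p) + (dird v \<phi> p $ None) *\<^sub>R null_rep (g p))) (at p)"
    by (rule has_derivative_scaleR)
  then have "(\<phi> has_derivative
      (\<lambda>v. \<mu> p *\<^sub>R ?L (dird v g p) + (dird v \<phi> p $ None) *\<^sub>R null_rep (g p))) (at p)"
    unfolding \<phi>[symmetric] .
  from dird_eqI[OF this, of 1]
  have d1: "dird 1 \<phi> p = \<mu> p *\<^sub>R ?L (dird 1 g p) + (dird 1 \<phi> p $ None) *\<^sub>R null_rep (g p)" .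
  have gg: "g q \<bullet> g q = 1" for q using unit[of q] by (simp add: dot_square_norm)
  have "((\<lambda>q. g q \<bullet> g q) has_derivative (\<lambda>v. g p \<bullet> dird v g p + dird v g p \<bullet> g p)) (at p)"
    by (rule has_derivative_inner[OF dg dg])
  then have "(\<lambda>v. g p \<bullet> dird v g p + dird v g p \<bullet> g p) = (\<lambda>v. 0)"
    unfolding gg by (rule has_derivative_unique) (rule has_derivative_const)
  from fun_cong[OF this, of 1] have perp: "g p \<bullet> dird 1 g p = 0" by (simp add: inner_commute)
  have "lorentz (dird 1 \<phi> p) (dird 1 \<phi> p) = (\<mu> p)\<^sup>2 * (dird 1 g p \<bullet> dird 1 g p)"
    by (subst (1 2) d1) (simp add: lorentz_linear L(3-5) gg perp lorentz_commute[of "?L _" "null_rep _"] power2_eq_square)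
  then have eq: "(\<mu> p)\<^sup>2 * (dird 1 g p \<bullet> dird 1 g p) = 1" by (simp add: conf)
  have \<mu>pos: "\<mu> p > 0" using cone[of p] by (simp add: \<mu>_def forward_cone_def)
  have "(\<mu> p)\<^sup>2 = inverse (dird 1 g p \<bullet> dird 1 g p)" using eq pos by (simp add: field_simps)
  then have "\<mu> p = sqrt (inverse (dird 1 g p \<bullet> dird 1 g p))" using \<mu>pos by (metis less_imp_le real_sqrt_unique)
  also have "\<dots> = (dird 1 g p \<bullet> dird 1 g p) powr (- 1 / 2)"
    using pos by (simp add: real_sqrt_inverse powr_minus powr_half_sqrt)
  finally show "\<phi> p = (dird 1 g p \<bullet> dird 1 g p) powr (- 1 / 2) *\<^sub>R null_rep (g p)"
    using \<phi>[of p] by simp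
qed

text \<open>
  Smoothness of each single lift says nothing about its dependence on time; the formula for the lift
  transfers the joint smoothness of \<open>f\<close> to \<open>\<psi>\<close>.
\<close>

lemma normalized_lifts_smooth:
  assumes T: "open T" and f: "smooth_on (T \<times> UNIV) (\<lambda>(s, p). f s p)"
    and imm: "\<And>s. s \<in> T \<Longrightarrow> conformal_immersion \<omega>1 \<omega>2 (f s)"
    and lift: "\<And>s. s \<in> T \<Longrightarrow> normalized_lift \<omega>1 \<omega>2 (f s) (\<psi> s)"
  shows "vjsmooth T (\<lambda>s p. cvec (\<psi> s p))"
  unfolding vjsmooth_def jsmooth_def
proof
  fix i
  let ?S = "T \<times> (UNIV :: complex set)" and ?f = "\<lambda>(s, p). f s p"
  have S: "open ?S" by (rule open_slab[OF T])
  let ?E = "\<lambda>q. dird (0, 1) ?f q \<bullet> dird (0, 1) ?f q"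
  have E: "?E (s, p) = dird 1 (f s) p \<bullet> dird 1 (f s) p" if "s \<in> T" for s p
    by (simp add: smooth_on_slice(2)[OF T f that])
  have pos: "?E q > 0" if "q \<in> ?S" for q
    using that normalized_lift_formula(1)[OF imm lift] E by (cases q) auto
  have "smooth_on ?S ?E"
    by (intro smooth_on_bilinear[OF S bounded_bilinear_inner] smooth_on_dird f)
  then have sp: "smooth_on ?S (\<lambda>q. ?E q powr (- 1 / 2))"
    using pos by (intro smooth_on_powr[OF S])
  have comp: "smooth_on ?S (\<lambda>q. null_rep (?f q) $ i)"
  proof (cases i)
    case None
    then show ?thesis by (simp add: null_rep_def smooth_on_const)
  next
    case (Some k)
    have "smooth_on ?S (\<lambda>q. ?f q $ k)"
      by (rule smooth_on_bounded_linear[OF S bounded_linear_vec_nth f])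
    then show ?thesis by (simp add: null_rep_def Some)
  qed
  have "smooth_on ?S (\<lambda>q. complex_of_real (?E q powr (- 1 / 2) * null_rep (?f q) $ i))"
    by (intro smooth_on_bounded_linear[OF S bounded_linear_of_real]
        smooth_on_bilinear[OF S bounded_bilinear_mult] sp comp)
  then show "smooth_on ?S (\<lambda>(s, p). cvec (\<psi> s p) $ i)"
  proof (rule smooth_on_cong[OF S, rotated])
    fix q assume "q \<in> ?S"
    then obtain s p where q: "q = (s, p)" "s \<in> T" by auto
    have "\<psi> s p = ?E (s, p) powr (- 1 / 2) *\<^sub>R null_rep (f s p)"
      unfolding E[OF q(2)] by (rule normalized_lift_formula(2)[OF imm[OF q(2)] lift[OF q(2)]])
    then show "complex_of_real (?E q powr (- 1 / 2) * null_rep (?f q) $ i) = (case q of (s, p) \<Rightarrow> cvec (\<psi> s p) $ i)"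
      unfolding q(1) by (simp add: cvec_def)
  qed
qed

section \<open>The Davey--Stewartson flow at an isothermic surface\<close>

lemma d_t_cong:
  assumes "open T" "s \<in> T" "\<And>r. r \<in> T \<Longrightarrow> g r p = h r q"
  shows "d_t g s p = d_t h s q"
proof -
  have "((\<lambda>r. g r p) has_vector_derivative D) (at s) \<longleftrightarrow> ((\<lambda>r. h r q) has_vector_derivative D) (at s)" for D
    using has_vector_derivative_transform_within_open[OF _ assms(1,2), of "\<lambda>r. g r p" D "\<lambda>r. h r q"]
      has_vector_derivative_transform_within_open[OF _ assms(1,2), of "\<lambda>r. h r q" D "\<lambda>r. g r p"]
      assms(3) by auto
  then show ?thesis by (simp add: d_t_def vector_derivative_def)
qed

lemma d_t_locally_const:
  assumes "open T" "s \<in> T" "\<And>r. r \<in> T \<Longrightarrow> g r p = k"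
  shows "d_t g s p = 0"
  using d_t_cong[OF assms(1,2), of g p "\<lambda>_ _. k" p] assms(3) by (simp add: d_t_def)

lemma d_t_cvec:
  assumes "open T" "vjsmooth T (\<lambda>s p. cvec (\<psi> s p))" "s \<in> T"
  shows "cvec (vector_derivative (\<lambda>r. \<psi> r p) (at s)) = d_t (\<lambda>s p. cvec (\<psi> s p)) s p"
proof -
  have d: "((\<lambda>r. cvec (\<psi> r p)) has_vector_derivative d_t (\<lambda>s p. cvec (\<psi> s p)) s p) (at s)"
    by (rule vjsmooth_d_t_nth(2)[OF assms])
  have "linear Rev" by (rule linearI) (simp_all add: vec_eq_iff Rev_def)
  then have "bounded_linear Rev" by (simp add: linear_conv_bounded_linear)
  from bounded_linear.has_vector_derivative[OF this d]
  have r: "((\<lambda>r. \<psi> r p) has_vector_derivative Rev (d_t (\<lambda>s p. cvec (\<psi> s p)) s p)) (at s)" by simp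
  have "linear cvec" by (rule linearI) (simp_all add: vec_eq_iff cvec_def complex_eq_iff)
  then have "bounded_linear cvec" by (simp add: linear_conv_bounded_linear)
  from bounded_linear.has_vector_derivative[OF this r]
  have "((\<lambda>r. cvec (\<psi> r p)) has_vector_derivative cvec (Rev (d_t (\<lambda>s p. cvec (\<psi> s p)) s p))) (at s)" .
  from vector_derivative_unique_at[OF this d] vector_derivative_at[OF r] show ?thesis by simp
qed

lemma periodic_wirtv:
  assumes "vsmooth g" "periodic \<omega>1 \<omega>2 g"
  shows "periodic \<omega>1 \<omega>2 (wirtv e g)"
proof -
  have shift: "wirtv e g (p + \<omega>) = wirtv e g p" if "\<And>q. g (q + \<omega>) = g q" for \<omega> p
  proof -
    have "dird v (\<lambda>q. g q $ i) (p + \<omega>) = dird v (\<lambda>q. g q $ i) p" for v i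
    proof -
      have d: "((\<lambda>q. g q $ i) has_derivative (\<lambda>v. dird v (\<lambda>q. g q $ i) (p + \<omega>))) (at (p + \<omega>))"
        using assms(1) by (intro smooth_on_has_derivative[of UNIV]) (auto simp: vsmooth_def)
      have "((\<lambda>q. q + \<omega>) has_derivative (\<lambda>v. v)) (at p)"
        by (auto intro!: derivative_eq_intros)
      from has_derivative_compose[OF this d]
      have "((\<lambda>q. g q $ i) has_derivative (\<lambda>v. dird v (\<lambda>q. g q $ i) (p + \<omega>))) (at p)"
        by (simp add: that)
      from dird_eqI[OF this] show ?thesis by simp
    qed
    then show ?thesis by (simp add: vec_eq_iff wirtv_def wirt_def)
  qed
  show ?thesis using assms(2) by (auto simp: periodic_def intro!: shift)
qed

theorem mainTheorem8:
  fixes \<omega>1 \<omega>2 :: complex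
    and T :: "real set"
    and f :: "real \<Rightarrow> complex \<Rightarrow> real ^ 5"
    and \<psi> :: "real \<Rightarrow> complex \<Rightarrow> lvec"
    and J :: "real \<Rightarrow> complex \<Rightarrow> lvec \<Rightarrow> lvec"
    and c b :: "real \<Rightarrow> complex \<Rightarrow> complex"
    and \<kappa> :: "real \<Rightarrow> complex \<Rightarrow> lvecC"
    and a :: "real \<Rightarrow> complex \<Rightarrow> real"
    and \<sigma> :: "real \<Rightarrow> complex \<Rightarrow> lvec"
    and t :: real
  assumes lattice: "lattice_basis \<omega>1 \<omega>2"
    and interval: "open T" "is_interval T"
    and smooth_family: "smooth_on (T \<times> UNIV) (\<lambda>(s, p). f s p)"
    and immersions: "\<And>s. s \<in> T \<Longrightarrow> conformal_immersion \<omega>1 \<omega>2 (f s)"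
    and lifts: "\<And>s. s \<in> T \<Longrightarrow> normalized_lift \<omega>1 \<omega>2 (f s) (\<psi> s)"
    and rotation: "normal_rotation \<omega>1 \<omega>2 T \<psi> J"
    and invariants: "\<And>s. s \<in> T \<Longrightarrow> schwarzian_hopf (\<psi> s) (c s) (\<kappa> s)"
    and variation: "\<And>s. s \<in> T \<Longrightarrow> variation_components \<psi> s (a s) (b s) (\<sigma> s)"
    and flow: "\<And>s p. s \<in> T \<Longrightarrow> \<sigma> s p = Rev (complexify (J s p) (\<kappa> s p))"
    and b_mean: "\<And>s. s \<in> T \<Longrightarrow> torus_integral \<omega>1 \<omega>2 (b s) = 0"
    and time: "t \<in> T"
    and isothermic_t: "isothermic (\<kappa> t)"
  shows "(\<forall>p. b t p = 0) \<and>
    (\<forall>p. D_t \<psi> \<kappa> t p =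
       complexify (J t p) (D_z (\<psi> t) (D_z (\<psi> t) (\<kappa> t)) p + (c t p / 2) *s \<kappa> t p)) \<and>
    (\<forall>p. Imv (D_t \<psi> \<kappa> t p) = 0)"
proof -
  note T = interval(1)
  define \<Psi> where "\<Psi> s p = cvec (\<psi> s p)" for s p
  have js: "vjsmooth T \<Psi>"
    unfolding \<Psi>_def[abs_def] by (rule normalized_lifts_smooth[OF T smooth_family immersions lifts])
  have surface: "conformal_lift (\<psi> s)" if "s \<in> T" for s
    using lifts[OF that] unfolding normalized_lift_def by unfold_locales auto
  interpret S: rotated_lift "\<psi> t" "J t"
  proof (intro rotated_lift.intro surface[OF time] rotated_lift_axioms.intro)
    show "continuous_on UNIV (\<lambda>p. J t p (N_proj (\<psi> t) p w))" for w
    proof -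
      have "continuous_on (T \<times> UNIV) (\<lambda>(t, p). J t p (N_proj (\<psi> t) p w))"
        using rotation by (simp add: normal_rotation_def)
      moreover have "continuous_on UNIV (\<lambda>p::complex. (t, p))"
        by (intro continuous_on_Pair continuous_on_const continuous_on_id)
      ultimately show ?thesis
        using continuous_on_compose2[of "T \<times> UNIV" _ UNIV "\<lambda>p. (t, p)"] time by fastforce
    qed
  qed (use rotation time in \<open>auto simp: normal_rotation_def\<close>)
  have S\<Phi>: "(\<lambda>p. cvec (\<psi> t p)) = \<Psi> t" by (simp add: \<Psi>_def[abs_def])
  note hopf = S.schwarzian_hopf_smooth[OF invariants[OF time]]

  define k where "k p = Rev (\<kappa> t p)" for p
  have \<kappa>_real: "\<kappa> t p = cvec (k p)" for p
    using isothermic_t cvec_Rev[of "\<kappa> t p"] by (simp add: isothermic_def k_def)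
  have kN: "k p \<in> N_fibre (\<psi> t) p" for p
    using hopf(4)[of p] by (simp add: N_fibreC_def k_def)
  have \<sigma>: "cvec (\<sigma> t p) = complexify (J t p) (\<kappa> t p)" and \<sigma>J: "\<sigma> t p = J t p (k p)" for p
    unfolding flow[OF time] \<kappa>_real complexify_linear(3)[OF S.J_lin] by simp_all
  have \<sigma>_N: "cvec (\<sigma> t p) \<in> N_fibreC (\<psi> t) p" for p
    using S.J_N[OF kN] by (simp add: N_fibreC_def \<sigma>J subspace_0[OF S.N_fibre_subspace])
  note \<sigma>_perp = \<sigma>_N[unfolded S.N_fibreC_iff]
  have \<sigma>\<kappa>: "lorentzC (cvec (\<sigma> t p)) (\<kappa> t p) = 0" for p
    using S.J_perp[OF kN] by (simp add: \<kappa>_real \<sigma>J lorentzC_cvec lorentz_commute[of "J t p (k p)"])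
  have \<kappa>_perp: "lorentzC (\<kappa> t p) (S.\<Phi> p) = 0" "lorentzC (\<kappa> t p) (S.\<Phi>z p) = 0" "lorentzC (\<kappa> t p) (S.\<Phi>zb p) = 0" for p
    using hopf(4)[of p] by (auto simp: S.N_fibreC_iff)

  define W where "W = d_t \<Psi> t"
  have W_smooth: "vsmooth W"
    unfolding W_def by (rule vjsmooth_slice[OF T vjsmooth_d_t[OF T js] time])
  have W: "W p = of_real (a t p) *s S.\<Phi> p + b t p *s S.\<Phi>z p + cnj (b t p) *s S.\<Phi>zb p + cvec (\<sigma> t p)" for p
    using variation[OF time] d_t_cvec[OF T js[unfolded \<Psi>_def[abs_def]] time, of p]
    by (simp add: variation_components_def W_def \<Psi>_def[abs_def])
  have W_perp: "lorentzC (W p) (S.\<Phi> p) = 0" "lorentzC (W p) (S.\<Phi>z p) = cnj (b t p) / 2"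
    "lorentzC (W p) (S.\<Phi>zb p) = b t p / 2" "lorentzC (W p) (S.\<Theta> p) = - of_real (a t p) / 2"
    "lorentzC (W p) (\<kappa> t p) = 0" for p
    using \<sigma>_perp[of p] \<sigma>\<kappa>[of p] \<kappa>_perp[of p] lorentzC_commute[of "\<kappa> t p"] by (simp_all add: W)

  have t_deriv: "d_t (\<lambda>s. wirtv e (\<Psi> s)) t p = wirtv e W p" and jw: "vjsmooth T (\<lambda>s. wirtv e (\<Psi> s))" for e p
    unfolding W_def by (rule vjsmooth_wirtv[OF T js] time)+
  \<comment> \<open>The first half of the conformality condition, differentiated in time.\<close>
  have null: "lorentzC (dv_z W p) (S.\<Phi>z p) = 0" for p
  proof -
    have "d_t (\<lambda>s p. lorentzC (wirtv (- \<i>) (\<Psi> s) p) (wirtv (- \<i>) (\<Psi> s) p)) t p = 0"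
    proof (rule d_t_locally_const[OF T time])
      fix r assume "r \<in> T"
      then interpret R: conformal_lift "\<psi> r" by (rule surface)
      show "lorentzC (wirtv (- \<i>) (\<Psi> r) p) (wirtv (- \<i>) (\<Psi> r) p) = 0"
        using R.gram(2)[of p] by (simp add: dv_z_wirt \<Psi>_def[abs_def])
    qed
    then show ?thesis
      using jsmooth_lorentzC(2)[OF T jw jw time, of "- \<i>" "- \<i>" p]
        lorentzC_commute[of "wirtv (- \<i>) W p" "wirtv (- \<i>) (\<Psi> t) p"]
      by (simp add: t_deriv dv_z_wirt S\<Phi>)
  qed
  \<comment> \<open>The second half of the conformality condition, differentiated in time.\<close>
  have conf: "lorentzC (dv_z W p) (S.\<Phi>zb p) + lorentzC (S.\<Phi>z p) (dv_zbar W p) = 0" for p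
  proof -
    have "d_t (\<lambda>s p. lorentzC (wirtv (- \<i>) (\<Psi> s) p) (wirtv \<i> (\<Psi> s) p)) t p = 0"
    proof (rule d_t_locally_const[OF T time])
      fix r assume "r \<in> T"
      then interpret R: conformal_lift "\<psi> r" by (rule surface)
      show "lorentzC (wirtv (- \<i>) (\<Psi> r) p) (wirtv \<i> (\<Psi> r) p) = 1 / 2"
        using R.gram(4)[of p] by (simp add: dv_z_wirt dv_zbar_wirt \<Psi>_def[abs_def])
    qed
    then show ?thesis
      using jsmooth_lorentzC(2)[OF T jw jw time, of "- \<i>" \<i> p]
      by (simp add: t_deriv dv_z_wirt dv_zbar_wirt S\<Phi>)
  qed

  have cnj_b: "(\<lambda>p. cnj (b t p)) = (\<lambda>p. 2 * lorentzC (W p) (S.\<Phi>z p))"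
    by (simp add: W_perp)
  have cnj_b_smooth: "smooth (\<lambda>p. cnj (b t p))"
    unfolding cnj_b by (intro smooth_mult smooth_on_const smooth_lorentzC W_smooth S.vsmooth_lift open_UNIV)
  have b_smooth: "smooth (b t)" using smooth_cnj[OF open_UNIV cnj_b_smooth] by simp
  have "d_z (\<lambda>p. cnj (b t p)) p = 0" for p
  proof -
    have "d_z (\<lambda>p. lorentzC (W p) (S.\<Phi>z p)) p = lorentzC (W p) (dv_z S.\<Phi>z p)"
      using wirt_lorentzC[OF W_smooth S.vsmooth_lift(2), of "- \<i>" p] null[of p]
      by (simp add: d_z_wirt dv_z_wirt)
    also have "\<dots> = 0" by (simp add: hopf(6) W_perp)
    finally show ?thesis
      unfolding cnj_b d_z_wirt
      by (simp add: wirt_mult smooth_on_const smooth_lorentzC[OF W_smooth S.vsmooth_lift(2)] wirt_const)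
  qed
  then have b_hol: "d_zbar (b t) p = 0" for p
    using wirt_cnj[OF b_smooth, of "- \<i>" p] by (simp add: d_z_wirt d_zbar_wirt)
  have b_periodic: "periodic \<omega>1 \<omega>2 (b t)"
  proof -
    have \<Psi>_per: "periodic \<omega>1 \<omega>2 (\<Psi> s)" if "s \<in> T" for s
      using lifts[OF that] by (simp add: normalized_lift_def periodic_def \<Psi>_def)
    have "periodic \<omega>1 \<omega>2 W"
      using \<Psi>_per unfolding periodic_def W_def by (auto intro: d_t_cong[OF T time])
    moreover have "periodic \<omega>1 \<omega>2 S.\<Phi>z"
      unfolding dv_z_wirt by (rule periodic_wirtv) (use \<Psi>_per[OF time] in \<open>simp_all add: S\<Phi>[symmetric]\<close>)
    ultimately have "periodic \<omega>1 \<omega>2 (\<lambda>p. cnj (cnj (b t p)))"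
      unfolding cnj_b[THEN fun_cong] periodic_def by simp
    then show ?thesis by simp
  qed
  have b0: "b t p = 0" for p
    by (rule holomorphic_torus_zero_mean[OF lattice b_periodic b_smooth b_hol b_mean[OF time]])

  have a0: "a t p = 0" for p
  proof -
    have "lorentzC (dv_z W p) (S.\<Phi>zb p) = of_real (a t p) / 2"
      using lorentzC_wirtv_swap[OF W_smooth S.vsmooth_lift(3), of 0 "- \<i>" p]
      by (simp add: W_perp b0 dv_z_wirt[symmetric] S.dv_z_zbar)
    moreover have "lorentzC (dv_zbar W p) (S.\<Phi>z p) = of_real (a t p) / 2"
      using lorentzC_wirtv_swap[OF W_smooth S.vsmooth_lift(2), of 0 \<i> p]
      by (simp add: W_perp b0 dv_zbar_wirt[symmetric])
    ultimately have "complex_of_real (a t p) / 2 + of_real (a t p) / 2 = 0"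
      using conf[of p] by (metis lorentzC_commute)
    then have "2 * (complex_of_real (a t p) / 2) = 0" by (simp only: mult_2)
    then show ?thesis by simp
  qed
  have W\<sigma>: "W = (\<lambda>p. complexify (J t p) (\<kappa> t p))"
    by (simp add: fun_eq_iff W a0 b0 \<sigma>)
  have W_N: "W p \<in> N_fibreC (\<psi> t) p" for p using \<sigma>_N[of p] by (simp add: W\<sigma> \<sigma>)

  define X where "X p = D_z (\<psi> t) (D_z (\<psi> t) (\<kappa> t)) p + (c t p / 2) *s \<kappa> t p" for p
  have evolution: "D_t \<psi> \<kappa> t p = complexify (J t p) (X p)" for p
  proof -
    \<comment> \<open>\<open>?K\<close> writes \<open>\<kappa>\<close> in terms of the lift alone, as \<open>c / 4 = \<langle>\<psi>\<^sub>z\<^sub>z, \<psi>\<^sub>z\<^sub>z\<^sub>b\<^sub>a\<^sub>r\<rangle>\<close>, so that it can be differentiated in \<open>t\<close>.\<close>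
    let ?zz = "\<lambda>s. wirtv (- \<i>) (wirtv (- \<i>) (\<Psi> s))"
    let ?c = "\<lambda>s p. lorentzC (?zz s p) (wirtv \<i> (wirtv (- \<i>) (\<Psi> s)) p)"
    let ?K = "\<lambda>s p. (?zz s p + ?c s p *s \<Psi> s p) + ?c s p *s \<Psi> s p"
    have jzz: "vjsmooth T ?zz" "vjsmooth T (\<lambda>s. wirtv \<i> (wirtv (- \<i>) (\<Psi> s)))"
      by (intro vjsmooth_wirtv[OF T] js)+
    have jc: "jsmooth T ?c" by (rule jsmooth_lorentzC[OF T jzz])
    have K: "\<kappa> s p = ?K s p" and c: "c s p / 2 = 2 * ?c s p" if "s \<in> T" for s p
    proof -
      interpret R: conformal_lift "\<psi> s" by (rule surface[OF that])
      note h = R.schwarzian_hopf_smooth[OF invariants[OF that]]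
      show c: "c s p / 2 = 2 * ?c s p"
        using h(1)[of p] by (simp add: dv_z_wirt dv_zbar_wirt \<Psi>_def[abs_def])
      show "\<kappa> s p = ?K s p"
        unfolding h(5)[of p] c by (simp add: dv_z_wirt \<Psi>_def[abs_def] vec_eq_iff algebra_simps)
    qed
    have "d_t ?zz t p = dv_z (dv_z W) p"
    proof -
      have "d_t ?zz t p = wirtv (- \<i>) (d_t (\<lambda>s. wirtv (- \<i>) (\<Psi> s)) t) p"
        by (rule vjsmooth_wirtv(2)[OF T jw time])
      moreover have "d_t (\<lambda>s. wirtv (- \<i>) (\<Psi> s)) t = wirtv (- \<i>) W" by (rule ext) (rule t_deriv)
      ultimately show ?thesis by (simp add: dv_z_wirt)
    qed
    moreover have "d_t ?K t p = d_t ?zz t p + d_t ?c t p *s \<Psi> t p + ?c t p *s W p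
        + d_t ?c t p *s \<Psi> t p + ?c t p *s W p"
      unfolding W_def
      using vjsmooth_add_scale(2)[OF T vjsmooth_add_scale(1)[OF T jzz(1) jc js] jc js time, of p]
        vjsmooth_add_scale(2)[OF T jzz(1) jc js time, of p] by simp
    moreover have "vector_derivative (\<lambda>s. \<kappa> s p) (at t) = d_t ?K t p"
      using d_t_cong[OF T time, of \<kappa> p ?K p] K by (simp add: d_t_def)
    ultimately have "vector_derivative (\<lambda>s. \<kappa> s p) (at t) =
        dv_z (dv_z W) p + (2 * d_t ?c t p) *s S.\<Phi> p + (c t p / 2) *s W p"
      by (simp add: c[OF time] \<Psi>_def vec_eq_iff algebra_simps)
    then have "D_t \<psi> \<kappa> t p = S.projC p (dv_z (dv_z W) p) + (c t p / 2) *s W p"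
      by (simp only: D_t_def S.complexify_N_proj S.projC_linear S.projC_tangent S.projC_id[OF W_N]) simp
    also have "S.projC p (dv_z (dv_z W) p) = D_z (\<psi> t) (D_z (\<psi> t) W) p"
      by (rule S.normal_second_derivative[OF W_smooth W_N, symmetric])
    also have "\<dots> = complexify (J t p) (D_z (\<psi> t) (D_z (\<psi> t) (\<kappa> t)) p)"
      unfolding W\<sigma> by (rule S.J_second_derivative[OF hopf(4,3)])
    finally show ?thesis
      by (simp add: X_def W\<sigma> complexify_linear[OF S.J_lin])
  qed
  have "Imv (D_t \<psi> \<kappa> t p) = 0" for p
  proof -
    have "cvec (Rev (X p)) = X p"
      unfolding X_def by (rule cvec_Rev[OF S.real_hopf_codazzi[OF invariants[OF time] isothermic_t]])
    then have "D_t \<psi> \<kappa> t p = cvec (J t p (Rev (X p)))"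
      using evolution[of p] complexify_linear(3)[OF S.J_lin, of p "Rev (X p)"] by simp
    then show ?thesis by simp
  qed
  then show ?thesis using b0 evolution by (simp add: X_def)
qed

end
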